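(* Let $\theta>0$, let $\mathbf P^+$ be a GEM$(\theta)$ sequence, and let $\tilde Q$ be a stochastic matrix on the discrete space $\mathcal X$ without absorbing states and with stationary distribution $\mu$. Let $\mathbf T'$ be a homogeneous Markov chain with kernel $\tilde Q$ and initial law $\mu$, independent of $\mathbf P^+$. Set $\tilde G=\theta(\tilde Q-I)$, $\tilde G'_{i,j}=\frac{\mu_j}{\mu_i}\tilde G_{j,i}\mathbb 1(\mu_i\ne0)$ and $\tilde Q'=I+\tilde G'/\theta$. Then $$\Big\langle\sum_{j=1}^\infty P^+_j\delta_{T'_j}(l):l\in\mathcal X\Big\rangle\overset d=\nu,$$ where $\nu$ is the distributional limit of the empirical occupation measures $\nu_n=\langle\frac1n\sum_{j=1}^n\delta_{T_j}(l)\rangle_{l\in\mathcal X}$ of the time-inhomogeneous Markov chain $\mathbf T$ with kernels $K_n=I+\frac{\tilde G'}{n}\mathbb 1(n>M)$ (for $M\in\mathbb N$ as in the time-inhomogeneous theorem, applied with generator $\tilde G'$) started from any distribution $\pi$ satisfying $\pi^t(\tilde Q')^n\to\mu^t$ entrywise.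
   Context: GEM$(\theta)$: $P_j=X_j\prod_{i<j}(1-X_i)$ with i.i.d. Beta$(1,\theta)$ fractions $X_j$. Time-inhomogeneous chain with kernels $K_n$: $\mathbb P(T_{n+1}=j\mid T_n=i)=K_n(i,j)$, with $M$ an integer exceeding $\inf\{r>0:I+r^{-1}\tilde G'\text{ non-negative}\}$. Convergence in distribution of $\nu_n$ is in the coordinatewise topology on probability vectors on $\mathcal X$. *)

theory Defs
  imports "HOL-Probability.Probability"
begin

definition beta_density :: "real \<Rightarrow> real \<Rightarrow> real \<Rightarrow> ennreal" where
  "beta_density a b x =
     (if 0 < x \<and> x < 1 then ennreal (x powr (a - 1) * (1 - x) powr (b - 1) / Beta a b) else 0)"

text \<open>GEM weights built from stick-breaking fractions X_1, X_2, ... (index 0 unused).\<close>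
definition gem_weight :: "(nat \<Rightarrow> real) \<Rightarrow> nat \<Rightarrow> real" where
  "gem_weight X j = X j * (\<Prod>i\<in>{1..<j}. (1 - X i))"

definition idm :: "'x \<Rightarrow> 'x \<Rightarrow> real" where
  "idm i j = (if i = j then 1 else 0)"

fun mpow :: "('x \<Rightarrow> 'x \<Rightarrow> real) \<Rightarrow> nat \<Rightarrow> 'x \<Rightarrow> 'x \<Rightarrow> real" where
  "mpow A 0 = idm"
| "mpow A (Suc n) = (\<lambda>i j. \<Sum>\<^sub>\<infinity>k. mpow A n i k * A k j)"

definition stochastic :: "('x \<Rightarrow> 'x \<Rightarrow> real) \<Rightarrow> bool" where
  "stochastic Q \<longleftrightarrow> (\<forall>i j. 0 \<le> Q i j) \<and> (\<forall>i. (Q i has_sum 1) UNIV)"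

definition prob_vector :: "('x \<Rightarrow> real) \<Rightarrow> bool" where
  "prob_vector p \<longleftrightarrow> (\<forall>i. 0 \<le> p i) \<and> (p has_sum 1) UNIV"

definition stationary :: "('x \<Rightarrow> 'x \<Rightarrow> real) \<Rightarrow> ('x \<Rightarrow> real) \<Rightarrow> bool" where
  "stationary Q \<mu> \<longleftrightarrow> prob_vector \<mu> \<and> (\<forall>j. ((\<lambda>i. \<mu> i * Q i j) has_sum \<mu> j) UNIV)"

text \<open>A sequence T_1, T_2, ... (index 0 unused) on M is a Markov chain with initial law p and
  time-dependent kernels K: P(T_1 = x_1, ..., T_n = x_n) = p x_1 * prod_{k<n} K k x_k x_{k+1}.
  The transition from T_k to T_{k+1} uses K k.\<close>
definition markov_chain ::
  "'a measure \<Rightarrow> (nat \<Rightarrow> 'a \<Rightarrow> 'x) \<Rightarrow> ('x \<Rightarrow> real) \<Rightarrow> (nat \<Rightarrow> 'x \<Rightarrow> 'x \<Rightarrow> real) \<Rightarrow> bool" where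
  "markov_chain M T p K \<longleftrightarrow>
     (\<forall>j. T j \<in> measurable M (count_space UNIV)) \<and>
     (\<forall>n\<ge>1. \<forall>xs :: nat \<Rightarrow> 'x.
        measure M {\<omega>\<in>space M. \<forall>k\<in>{1..n}. T k \<omega> = xs k}
          = p (xs 1) * (\<Prod>k\<in>{1..<n}. K k (xs k) (xs (k + 1))))"

text \<open>Convergence in distribution of random elements of the space of functions 'x => real
  with the coordinatewise (product) topology: expectations of bounded continuous functionals
  converge.  Y n lives on M, V lives on N.\<close>
definition conv_in_distr ::
  "'a measure \<Rightarrow> (nat \<Rightarrow> 'a \<Rightarrow> ('x \<Rightarrow> real)) \<Rightarrow> 'b measure \<Rightarrow> ('b \<Rightarrow> ('x \<Rightarrow> real)) \<Rightarrow> bool" where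
  "conv_in_distr M Y N V \<longleftrightarrow>
     (\<forall>f :: ('x \<Rightarrow> real) \<Rightarrow> real. continuous_on UNIV f \<and> bounded (range f) \<longrightarrow>
        (\<lambda>n. \<integral>\<omega>. f (Y n \<omega>) \<partial>M) \<longlonglongrightarrow> (\<integral>\<omega>. f (V \<omega>) \<partial>N))"

end

theory Submission
  imports Defs
begin

text \<open>For \<open>h\<close> with values in \<open>[-1, 1]\<close> put \<open>S n = h(T 1) + ... + h(T n)\<close>, let \<open>\<nu>(h)\<close> be the integral
  of \<open>h\<close> against the random measure \<open>\<Sum> P j \<delta>(T' j)\<close>, and let
  \<open>L r g = E[\<nu>(h)^r g(T' 1)]\<close>. Splitting off the first stick and reversing \<open>T'\<close> in time (under \<open>\<mu>\<close>,
  the law of \<open>T' 1\<close> given \<open>T' 2, T' 3, ...\<close> is row \<open>T' 2\<close> of \<open>Q'\<close>) gives, by the recursion of the Beta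
  moments, \<open>(r + \<theta>) L r g = \<theta> L r (Q' g) + r L (r - 1) (h g)\<close>. On the other side,
  the one-step expansion of \<open>E[(S n / n)^r g(T n)]\<close> shows that its distance to \<open>L r g\<close>, uniformly over
  \<open>|g| \<le> 1\<close>, is multiplied by at most \<open>(n/(n+1))^r\<close> per step up to an error \<open>o(1/n)\<close>; for \<open>r \<ge> 1\<close> it
  tends to 0 by induction on \<open>r\<close>. The case \<open>r = 0\<close> is the convergence of the law of \<open>T n\<close> to \<open>\<mu>\<close>: the
  chain performs about \<open>\<theta> ln n\<close> jumps along \<open>Q'\<close>. Convergence of all moments of \<open>\<nu> n (h)\<close> yields that of
  \<open>E exp(\<nu> n (h))\<close>, and exponentials of finitely supported linear forms span a dense algebra of
  continuous functions on the compact cube.\<close>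

section \<open>Discrete laws and kernels\<close>

text \<open>The test function \<open>g(T n)\<close> has to be carried along because moments of
  \<open>S n / n\<close> alone do not close up: one step of the chain replaces \<open>g\<close> by
  \<open>K n g\<close>. As that function changes with \<open>n\<close>, the comparison with
  \<open>L r\<close> must be uniform over bounded functions, and the entrywise convergence of the
  laws after \<open>k\<close> applications of \<open>Q'\<close> must first be upgraded to total
  variation.

  The case \<open>r = 0\<close> escapes the induction. The factor \<open>(n/(n+1))^r\<close> is then
  1, and the recursion for \<open>L\<close> degenerates to \<open>L 0 g = L 0 (Q' g)\<close>, which
  does not single out \<open>\<mu>\<close> when \<open>Q'\<close> has several invariant laws. This
  is where the hypothesis on \<open>\<pi>\<close> enters.

  On the GEM side, time reversal is a statement about finite paths, so moments are computed for the
  first \<open>R\<close> sticks before \<open>R\<close> tends to infinity.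

  The bound on \<open>m\<close> makes the matrices \<open>K n\<close> stochastic, but
  \<open>1 - \<theta>/n\<close> may still be negative for some \<open>n > m\<close>. Early steps are
  therefore expanded by linearity with signed coefficients, not as mixtures of staying and
  jumping.\<close>

lemma has_sum_count_space:
  fixes f :: "'a \<Rightarrow> real"
  assumes "(f has_sum s) UNIV"
  shows "integrable (count_space UNIV) f" "(\<integral>x. f x \<partial>count_space UNIV) = s"
proof -
  have "f summable_on UNIV" using assms by (auto simp: summable_on_def)
  then have "Infinite_Sum.abs_summable_on f UNIV"
    by (rule summable_on_iff_abs_summable_on_real[THEN iffD1])
  then have *: "Infinite_Set_Sum.abs_summable_on f UNIV" by (rule abs_summable_equivalent[THEN iffD1])
  then show "integrable (count_space UNIV) f" by (simp add: abs_summable_on_def)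
  have "(\<integral>x. f x \<partial>count_space UNIV) = infsetsum f UNIV" by (simp add: infsetsum_def)
  also have "\<dots> = infsum f UNIV" by (rule infsetsum_infsum[OF *])
  also have "\<dots> = s" by (rule infsumI[OF assms])
  finally show "(\<integral>x. f x \<partial>count_space UNIV) = s" .
qed

text \<open>With the converse above, this links \<open>has_sum\<close>, the language of the
  hypotheses, to integrals over counting measure, where dominated convergence and pmf expectations
  are available.\<close>

lemma has_sum_of_integrable_count_space:
  fixes f :: "'a \<Rightarrow> real"
  assumes "integrable (count_space UNIV) f"
  shows "(f has_sum (\<integral>x. f x \<partial>count_space UNIV)) UNIV"
proof -
  have *: "Infinite_Set_Sum.abs_summable_on f UNIV" using assms by (simp add: abs_summable_on_def)
  then have "Infinite_Sum.abs_summable_on f UNIV" by (rule abs_summable_equivalent[THEN iffD2])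
  then have "f summable_on UNIV" by (rule abs_summable_summable)
  then have "(f has_sum infsum f UNIV) UNIV" by (rule has_sum_infsum)
  also have "infsum f UNIV = (\<integral>x. f x \<partial>count_space UNIV)"
    using infsetsum_infsum[OF *] by (simp add: infsetsum_def)
  finally show ?thesis .
qed

section \<open>Expectations of bounded functions under discrete laws\<close>

lemma pmf_of_prob_vector:
  assumes "prob_vector p"
  obtains q where "\<And>i. pmf q i = p i"
proof -
  have p: "\<And>i. 0 \<le> p i" "(p has_sum 1) UNIV" using assms by (auto simp: prob_vector_def)
  have "(\<integral>\<^sup>+x. p x \<partial>count_space UNIV) = 1"
    using has_sum_count_space[OF p(2)] p(1) by (subst nn_integral_eq_integral) auto
  then have "\<And>i. pmf (embed_pmf p) i = p i" using p(1) by (intro pmf_embed_pmf) auto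
  then show ?thesis using that by blast
qed

lemma expectation_pmf_count_space:
  "measure_pmf.expectation p f = (\<integral>x. pmf p x * f x \<partial>count_space UNIV)" for f :: "'a \<Rightarrow> real"
  by (simp add: measure_pmf_eq_density integral_density)

lemma integrable_pmf_count_space:
  fixes f :: "'a \<Rightarrow> real"
  assumes "\<And>x. \<bar>f x\<bar> \<le> B"
  shows "integrable (count_space UNIV) (\<lambda>x. pmf p x * f x)"
proof -
  have "integrable (measure_pmf p) f"
    by (rule measure_pmf.integrable_const_bound[where B = B]) (use assms in auto)
  then show ?thesis by (simp add: measure_pmf_eq_density integrable_density)
qed

lemma integrable_pmf_bounded:
  fixes f :: "'a \<Rightarrow> real"
  assumes "\<And>x. \<bar>f x\<bar> \<le> B"
  shows "integrable (measure_pmf p) f"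
  by (rule measure_pmf.integrable_const_bound[where B = B]) (use assms in auto)

text \<open>A nonintegrable \<open>f\<close> has integral 0 by convention, so the bound survives
  without integrability; this is where \<open>0 \<le> B\<close> is used.\<close>

lemma (in prob_space) abs_expectation_le_AE:
  fixes f :: "'a \<Rightarrow> real"
  assumes "AE x in M. \<bar>f x\<bar> \<le> B" "0 \<le> B"
  shows "\<bar>expectation f\<bar> \<le> B"
proof (cases "integrable M f")
  case True
  have "\<bar>expectation f\<bar> \<le> expectation (\<lambda>x. \<bar>f x\<bar>)"
    using integral_norm_bound[of M f] by simp
  also have "\<dots> \<le> expectation (\<lambda>x. B)"
    by (rule integral_mono_AE) (use True assms in auto)
  finally show ?thesis by (simp add: prob_space)
qed (use assms in \<open>simp add: not_integrable_integral_eq\<close>)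

lemma (in prob_space) abs_expectation_le:
  fixes f :: "'a \<Rightarrow> real"
  assumes "\<And>x. x \<in> space M \<Longrightarrow> \<bar>f x\<bar> \<le> B" "0 \<le> B"
  shows "\<bar>expectation f\<bar> \<le> B"
  using assms by (intro abs_expectation_le_AE AE_I2) auto

lemma pmf_expectation_abs_le:
  fixes f :: "'a \<Rightarrow> real"
  assumes "\<And>x. \<bar>f x\<bar> \<le> B"
  shows "\<bar>measure_pmf.expectation p f\<bar> \<le> B"
  by (rule measure_pmf.abs_expectation_le) (use assms order_trans[OF abs_ge_zero assms] in auto)

text \<open>Adding \<open>B\<close> makes the integrand nonnegative and reduces the claim to
  \<open>nn_integral_bind_pmf\<close>; the shift cancels because every pmf has mass 1.\<close>

lemma expectation_bind_pmf:
  fixes f :: "'b \<Rightarrow> real"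
  assumes bd: "\<And>x. \<bar>f x\<bar> \<le> B"
  shows "measure_pmf.expectation (bind_pmf p q) f
    = measure_pmf.expectation p (\<lambda>x. measure_pmf.expectation (q x) f)"
proof -
  have int: "integrable (measure_pmf r) f" for r :: "'b pmf"
    by (rule integrable_pmf_bounded[OF bd])
  have int': "integrable (measure_pmf p) (\<lambda>x. measure_pmf.expectation (q x) f)"
    by (rule integrable_pmf_bounded[OF pmf_expectation_abs_le[OF bd]])
  have nn: "0 \<le> f x + B" for x using bd[of x] by linarith
  have Ef: "measure_pmf.expectation r (\<lambda>x. f x + B) = measure_pmf.expectation r f + B" for r :: "'b pmf"
    using int[of r] by simp
  have 1: "(\<integral>\<^sup>+x. ennreal (f x + B) \<partial>r) = ennreal (measure_pmf.expectation r f + B)" for r :: "'b pmf"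
    by (subst nn_integral_eq_integral) (use int[of r] nn Ef in auto)
  have nn': "0 \<le> measure_pmf.expectation r f + B" for r :: "'b pmf"
    using pmf_expectation_abs_le[of f B r] bd by fastforce
  have nn'': "0 \<le> measure_pmf.expectation p (\<lambda>x. measure_pmf.expectation (q x) f) + B"
    using pmf_expectation_abs_le[of "\<lambda>x. measure_pmf.expectation (q x) f" B p]
      pmf_expectation_abs_le[of f B] bd by fastforce
  have "ennreal (measure_pmf.expectation (bind_pmf p q) f + B)
      = (\<integral>\<^sup>+x. ennreal (measure_pmf.expectation (q x) f + B) \<partial>p)"
    unfolding 1[symmetric] nn_integral_bind_pmf ..
  also have "\<dots> = ennreal (measure_pmf.expectation p (\<lambda>x. measure_pmf.expectation (q x) f) + B)"
    by (subst nn_integral_eq_integral) (use int' nn' in auto)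
  finally have "measure_pmf.expectation (bind_pmf p q) f + B
      = measure_pmf.expectation p (\<lambda>x. measure_pmf.expectation (q x) f) + B"
    using ennreal_inj[OF nn' nn''] by blast
  then show ?thesis by simp
qed

text \<open>On a countable type the law of \<open>Z\<close> is carried by its atoms, hence is a pmf,
  and every \<open>F\<close> is measurable.\<close>

lemma law_pmf:
  fixes Z :: "'a \<Rightarrow> 'z::countable"
  assumes "prob_space M" and Z[measurable]: "Z \<in> measurable M (count_space UNIV)"
  obtains p where "\<And>z. pmf p z = measure M {\<omega>\<in>space M. Z \<omega> = z}"
    "\<And>F :: 'z \<Rightarrow> real. (\<integral>\<omega>. F (Z \<omega>) \<partial>M) = measure_pmf.expectation p F"
proof -
  interpret prob_space M by fact
  let ?D = "distr M (count_space UNIV) Z"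
  interpret D: prob_space ?D by (rule prob_space_distr) measurable
  have "AE x in ?D. measure ?D {x} \<noteq> 0"
    by (subst D.AE_support_countable) (auto intro!: exI[of _ UNIV])
  then have D: "measure_pmf (Abs_pmf ?D) = ?D"
    by (intro Abs_pmf_inverse) (auto intro: D.prob_space_axioms)
  show ?thesis
  proof (rule that[of "Abs_pmf ?D"])
    show "pmf (Abs_pmf ?D) z = measure M {\<omega>\<in>space M. Z \<omega> = z}" for z
      unfolding pmf.rep_eq D
      by (subst measure_distr) (auto intro!: arg_cong[where f = "measure M"])
    show "(\<integral>\<omega>. F (Z \<omega>) \<partial>M) = measure_pmf.expectation (Abs_pmf ?D) F" for F :: "'z \<Rightarrow> real"
      unfolding D by (subst integral_distr) auto
  qed
qed

text \<open>\<open>Z0\<close> need not be \<open>Z\<close>. Summing \<open>law\<close> over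
  \<open>y\<close> shows that they have the same distribution; in the reversal below,
  \<open>Z\<close> is a path from time 2 on and \<open>Z0\<close> the path from time 1 on.\<close>

lemma kernel_expectation:
  fixes Z :: "'a \<Rightarrow> 'z::countable" and Y :: "'a \<Rightarrow> 'y::countable" and Z0 :: "'b \<Rightarrow> 'z"
    and F :: "'z \<Rightarrow> 'y \<Rightarrow> real"
  assumes M: "prob_space M" and M0: "prob_space M0"
    and Z[measurable]: "Z \<in> measurable M (count_space UNIV)"
    and Y[measurable]: "Y \<in> measurable M (count_space UNIV)"
    and Z0: "Z0 \<in> measurable M0 (count_space UNIV)"
    and law: "\<And>z y. measure M {\<omega>\<in>space M. Z \<omega> = z \<and> Y \<omega> = y}
                = measure M0 {\<omega>\<in>space M0. Z0 \<omega> = z} * pmf (\<kappa> z) y"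
    and bd: "\<And>z y. \<bar>F z y\<bar> \<le> B"
  shows "(\<integral>\<omega>. F (Z \<omega>) (Y \<omega>) \<partial>M) = (\<integral>\<omega>. measure_pmf.expectation (\<kappa> (Z0 \<omega>)) (F (Z0 \<omega>)) \<partial>M0)"
proof -
  obtain p where p: "\<And>z. pmf p z = measure M0 {\<omega>\<in>space M0. Z0 \<omega> = z}"
    "\<And>F :: 'z \<Rightarrow> real. (\<integral>\<omega>. F (Z0 \<omega>) \<partial>M0) = measure_pmf.expectation p F"
    by (rule law_pmf[OF M0 Z0]) (erule that)
  have "(\<lambda>\<omega>. (Z \<omega>, Y \<omega>)) \<in> measurable M (count_space UNIV)" by measurable
  then obtain a where a: "\<And>z. pmf a z = measure M {\<omega>\<in>space M. (Z \<omega>, Y \<omega>) = z}"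
    "\<And>F :: 'z \<times> 'y \<Rightarrow> real. (\<integral>\<omega>. F (Z \<omega>, Y \<omega>) \<partial>M) = measure_pmf.expectation a F"
    by (rule law_pmf[OF M]) (erule that)
  have "a = bind_pmf p (\<lambda>z. map_pmf (Pair z) (\<kappa> z))"
  proof (rule pmf_eqI)
    fix zy :: "'z \<times> 'y"
    obtain z y where zy: "zy = (z, y)" by fastforce
    have 1: "pmf (map_pmf (Pair z') (\<kappa> z')) (z, y) = (if z' = z then pmf (\<kappa> z) y else 0)" for z'
    proof (cases "z' = z")
      case True
      then show ?thesis using pmf_map_inj'[of "Pair z" "\<kappa> z" y] by (simp add: inj_def)
    qed (auto simp: pmf_eq_0_set_pmf)
    \<comment> \<open>Only \<open>z' = z\<close> contributes to the mixture, since the first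
      component of the pair records the mixing variable.\<close>
    have "pmf (bind_pmf p (\<lambda>z. map_pmf (Pair z) (\<kappa> z))) zy = pmf p z * pmf (\<kappa> z) y"
      unfolding pmf_bind zy 1 by (subst integral_measure_pmf_real[where A = "{z}"]) (auto split: if_splits)
    then show "pmf a zy = pmf (bind_pmf p (\<lambda>z. map_pmf (Pair z) (\<kappa> z))) zy"
      by (simp add: a(1) zy law p(1))
  qed
  then have "(\<integral>\<omega>. F (Z \<omega>) (Y \<omega>) \<partial>M) = measure_pmf.expectation p (\<lambda>z. measure_pmf.expectation (\<kappa> z) (F z))"
    using a(2)[of "\<lambda>(z, y). F z y"]
      expectation_bind_pmf[of "\<lambda>(z, y). F z y" B p "\<lambda>z. map_pmf (Pair z) (\<kappa> z)"] bd
    by (simp add: split_beta)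
  then show ?thesis
    by (rule trans) (rule p(2)[of "\<lambda>z. measure_pmf.expectation (\<kappa> z) (F z)", symmetric])
qed

section \<open>Finite paths of Markov chains\<close>

lemma measurable_path [measurable]:
  fixes T :: "nat \<Rightarrow> 'a \<Rightarrow> 'x::countable"
  assumes "\<And>j. T j \<in> measurable M (count_space UNIV)"
  shows "(\<lambda>\<omega>. map (\<lambda>k. T k \<omega>) js) \<in> measurable M (count_space UNIV)"
proof (induction js)
  case (Cons j js)
  note [measurable] = Cons.IH assms
  have "(\<lambda>\<omega>. (\<lambda>(x, xs). x # xs) (T j \<omega>, map (\<lambda>k. T k \<omega>) js)) \<in> measurable M (count_space UNIV)"
    by (rule measurable_compose[of _ M "count_space UNIV"]) measurable
  then show ?case by simp
qed simp

text \<open>Times start at 1 and list positions at 0, so the state at time \<open>k\<close> is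
  \<open>zs ! (k - 1)\<close>.\<close>

lemma path_law:
  assumes "markov_chain M T p K" "length zs = n" "n \<ge> 1"
  shows "measure M {\<omega>\<in>space M. map (\<lambda>k. T k \<omega>) [1..<Suc n] = zs}
    = p (zs ! 0) * (\<Prod>k\<in>{1..<n}. K k (zs ! (k - 1)) (zs ! k))"
proof -
  have "map (\<lambda>k. T k \<omega>) [1..<Suc n] = zs \<longleftrightarrow> (\<forall>k\<in>{1..n}. T k \<omega> = zs ! (k - 1))" for \<omega>
  proof -
    have "map (\<lambda>k. T k \<omega>) [1..<Suc n] = zs \<longleftrightarrow> (\<forall>i<n. T (Suc i) \<omega> = zs ! i)"
      using assms(2) by (auto simp: list_eq_iff_nth_eq simp del: upt_Suc)
    also have "\<dots> \<longleftrightarrow> (\<forall>k\<in>{1..n}. T k \<omega> = zs ! (k - 1))"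
      by (force simp: Ball_def Suc_le_eq gr0_conv_Suc)
    finally show ?thesis .
  qed
  then show ?thesis
    using assms unfolding markov_chain_def
    by (simp del: upt_Suc)
qed

text \<open>\<open>F\<close> sees the whole past because the running average does, while the law of
  the next state depends on \<open>T n\<close> alone.\<close>

lemma markov_chain_step_expectation:
  fixes T :: "nat \<Rightarrow> 'a \<Rightarrow> 'x::countable" and F :: "'x list \<Rightarrow> 'x \<Rightarrow> real"
  assumes M: "prob_space M" and mc: "markov_chain M T p K" and n: "n \<ge> 1"
    and \<kappa>: "\<And>i j. pmf (\<kappa> i) j = K n i j"
    and bd: "\<And>z y. \<bar>F z y\<bar> \<le> B"
  shows "(\<integral>\<omega>. F (map (\<lambda>k. T k \<omega>) [1..<Suc n]) (T (Suc n) \<omega>) \<partial>M)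
    = (\<integral>\<omega>. measure_pmf.expectation (\<kappa> (T n \<omega>)) (F (map (\<lambda>k. T k \<omega>) [1..<Suc n])) \<partial>M)"
proof -
  have T: "T j \<in> measurable M (count_space UNIV)" for j
    using mc by (auto simp: markov_chain_def)
  have "(\<integral>\<omega>. F (map (\<lambda>k. T k \<omega>) [1..<Suc n]) (T (Suc n) \<omega>) \<partial>M)
    = (\<integral>\<omega>. measure_pmf.expectation (\<kappa> (last (map (\<lambda>k. T k \<omega>) [1..<Suc n])))
         (F (map (\<lambda>k. T k \<omega>) [1..<Suc n])) \<partial>M)"
  proof (rule kernel_expectation[where \<kappa> = "\<lambda>z. \<kappa> (last z)", OF M M measurable_path T measurable_path _ bd])
    fix z :: "'x list" and y
    show "measure M {\<omega>\<in>space M. map (\<lambda>k. T k \<omega>) [1..<Suc n] = z \<and> T (Suc n) \<omega> = y}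
      = measure M {\<omega>\<in>space M. map (\<lambda>k. T k \<omega>) [1..<Suc n] = z} * pmf (\<kappa> (last z)) y"
    \<comment> \<open>Lists of any other length are never attained, and both sides vanish.\<close>
    proof (cases "length z = n")
      case True
      have "{\<omega>\<in>space M. map (\<lambda>k. T k \<omega>) [1..<Suc n] = z \<and> T (Suc n) \<omega> = y}
        = {\<omega>\<in>space M. map (\<lambda>k. T k \<omega>) [1..<Suc (Suc n)] = z @ [y]}"
        by auto
      then have "measure M {\<omega>\<in>space M. map (\<lambda>k. T k \<omega>) [1..<Suc n] = z \<and> T (Suc n) \<omega> = y}
        = p ((z @ [y]) ! 0) * (\<Prod>k\<in>{1..<Suc n}. K k ((z @ [y]) ! (k - 1)) ((z @ [y]) ! k))"
        using path_law[OF mc, of "z @ [y]" "Suc n"] True by simp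
      also have "\<dots> = p (z ! 0) * (\<Prod>k\<in>{1..<n}. K k (z ! (k - 1)) (z ! k)) * K n (z ! (n - 1)) y"
      proof -
        have "(\<Prod>k\<in>{1..<n}. K k ((z @ [y]) ! (k - 1)) ((z @ [y]) ! k)) = (\<Prod>k\<in>{1..<n}. K k (z ! (k - 1)) (z ! k))"
          using True by (intro prod.cong) (auto simp: nth_append)
        then show ?thesis using n True by (simp add: nth_append)
      qed
      also have "\<dots> = measure M {\<omega>\<in>space M. map (\<lambda>k. T k \<omega>) [1..<Suc n] = z} * pmf (\<kappa> (last z)) y"
      proof -
        have "z \<noteq> []" using True n by auto
        then show ?thesis
          using path_law[OF mc True n] True by (simp add: \<kappa> last_conv_nth)
      qed
      finally show ?thesis .
    next
      case False
      then have "map (\<lambda>k. T k \<omega>) [1..<Suc n] \<noteq> z" for \<omega>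
        by (metis length_map length_upt diff_Suc_1)
      then show ?thesis by (simp del: upt_Suc)
    qed
  qed (rule T)+
  then show ?thesis using n by simp
qed

text \<open>In the path probability \<open>\<mu> y * Q y z0 * ...\<close> the state \<open>y\<close>
  at time 1 occurs in the first two factors only. The balance hypothesis rewrites these as
  \<open>\<mu> z0 * pmf (\<kappa> z0) y\<close>, and what remains is the probability that the path
  starting at time 1 is \<open>z\<close>. So the past state can be sampled by
  \<open>\<kappa>\<close> from a fresh path.\<close>

lemma stationary_reversal_expectation:
  fixes T :: "nat \<Rightarrow> 'a \<Rightarrow> 'x::countable" and F :: "'x list \<Rightarrow> 'x \<Rightarrow> real"
  assumes M: "prob_space M" and mc: "markov_chain M T \<mu> (\<lambda>_. Q)" and n: "n \<ge> 1"
    and \<kappa>: "\<And>i j. \<mu> i * pmf (\<kappa> i) j = \<mu> j * Q j i"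
    and bd: "\<And>z y. \<bar>F z y\<bar> \<le> B"
  shows "(\<integral>\<omega>. F (map (\<lambda>k. T (Suc k) \<omega>) [1..<Suc n]) (T 1 \<omega>) \<partial>M)
    = (\<integral>\<omega>. measure_pmf.expectation (\<kappa> (T 1 \<omega>)) (F (map (\<lambda>k. T k \<omega>) [1..<Suc n])) \<partial>M)"
proof -
  have T: "T j \<in> measurable M (count_space UNIV)" for j
    using mc by (auto simp: markov_chain_def)
  have "(\<integral>\<omega>. F (map (\<lambda>k. T (Suc k) \<omega>) [1..<Suc n]) (T 1 \<omega>) \<partial>M)
    = (\<integral>\<omega>. measure_pmf.expectation (\<kappa> (hd (map (\<lambda>k. T k \<omega>) [1..<Suc n])))
         (F (map (\<lambda>k. T k \<omega>) [1..<Suc n])) \<partial>M)"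
  proof (rule kernel_expectation[where \<kappa> = "\<lambda>z. \<kappa> (hd z)", OF M M measurable_path T measurable_path _ bd])
    fix z :: "'x list" and y
    show "measure M {\<omega>\<in>space M. map (\<lambda>k. T (Suc k) \<omega>) [1..<Suc n] = z \<and> T 1 \<omega> = y}
      = measure M {\<omega>\<in>space M. map (\<lambda>k. T k \<omega>) [1..<Suc n] = z} * pmf (\<kappa> (hd z)) y"
    proof (cases "length z = n")
      case True
      have "map (\<lambda>k. T k \<omega>) [1..<Suc (Suc n)] = T 1 \<omega> # map (\<lambda>k. T (Suc k) \<omega>) [1..<Suc n]" for \<omega>
        by (simp add: upt_conv_Cons map_Suc_upt[symmetric] comp_def del: upt_Suc)
      then have "{\<omega>\<in>space M. map (\<lambda>k. T (Suc k) \<omega>) [1..<Suc n] = z \<and> T 1 \<omega> = y}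
        = {\<omega>\<in>space M. map (\<lambda>k. T k \<omega>) [1..<Suc (Suc n)] = y # z}"
        by (auto simp del: upt_Suc)
      then have "measure M {\<omega>\<in>space M. map (\<lambda>k. T (Suc k) \<omega>) [1..<Suc n] = z \<and> T 1 \<omega> = y}
        = \<mu> y * (\<Prod>k\<in>{1..<Suc n}. Q ((y # z) ! (k - 1)) ((y # z) ! k))"
        using path_law[OF mc, of "y # z" "Suc n"] True by simp
      also have "\<dots> = \<mu> y * Q y (z ! 0) * (\<Prod>k\<in>{2..<Suc n}. Q ((y # z) ! (k - 1)) ((y # z) ! k))"
        using n by (subst prod.atLeast_Suc_lessThan) (auto simp: numeral_2_eq_2)
      also have "(\<Prod>k\<in>{2..<Suc n}. Q ((y # z) ! (k - 1)) ((y # z) ! k))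
        = (\<Prod>k\<in>{1..<n}. Q (z ! (k - 1)) (z ! k))"
        unfolding numeral_2_eq_2 One_nat_def prod.shift_bounds_Suc_ivl
        by (intro prod.cong) auto
      also have "\<mu> y * Q y (z ! 0) = \<mu> (z ! 0) * pmf (\<kappa> (hd z)) y"
        using True n by (cases z) (auto simp: \<kappa>)
      finally show ?thesis
        using path_law[OF mc True n] by (simp add: mult_ac)
    next
      case False
      then have "map (\<lambda>k. T k \<omega>) [1..<Suc n] \<noteq> z" "map (\<lambda>k. T (Suc k) \<omega>) [1..<Suc n] \<noteq> z" for \<omega>
        by (metis length_map length_upt diff_Suc_1)+
      then show ?thesis by (simp del: upt_Suc)
    qed
  qed (rule T)+
  moreover have "hd (map (\<lambda>k. T k \<omega>) [1..<Suc n]) = T 1 \<omega>" for \<omega>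
    using n by (simp add: hd_map del: upt_Suc)
  ultimately show ?thesis by simp
qed

section \<open>Empirical moments of the inhomogeneous chain\<close>

definition kernel_app :: "('x \<Rightarrow> 'y pmf) \<Rightarrow> ('y \<Rightarrow> real) \<Rightarrow> 'x \<Rightarrow> real" where
  "kernel_app q f i = measure_pmf.expectation (q i) f"

text \<open>The unit ball of the sup norm is stable under kernels and products; bounds uniform over
  it survive test functions that change with \<open>n\<close>.\<close>

definition unit_bounded :: "('x \<Rightarrow> real) \<Rightarrow> bool" where
  "unit_bounded g \<longleftrightarrow> (\<forall>x. \<bar>g x\<bar> \<le> 1)"

lemma unit_boundedD: "unit_bounded g \<Longrightarrow> \<bar>g x\<bar> \<le> 1"
  by (simp add: unit_bounded_def)

lemma unit_bounded_kernel_app: "unit_bounded g \<Longrightarrow> unit_bounded (kernel_app q g)"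
  unfolding unit_bounded_def kernel_app_def by (intro allI pmf_expectation_abs_le) auto

lemma unit_bounded_mult: "unit_bounded f \<Longrightarrow> unit_bounded g \<Longrightarrow> unit_bounded (\<lambda>x. f x * g x)"
  unfolding unit_bounded_def by (auto simp: abs_mult intro: mult_le_one)

lemma unit_bounded_power: "unit_bounded f \<Longrightarrow> unit_bounded (\<lambda>x. f x ^ n)"
  unfolding unit_bounded_def by (auto simp: power_abs intro: power_le_one)

text \<open>Scheffe's lemma: the positive part of \<open>pmf u - pmf (p k)\<close> is dominated by
  \<open>pmf u\<close>, so its integral tends to 0, and equal total masses turn this into a bound on
  the absolute difference.\<close>

lemma pmf_tendsto_total_variation:
  fixes p :: "nat \<Rightarrow> 'x::countable pmf"
  assumes lim: "\<And>j. (\<lambda>k. pmf (p k) j) \<longlonglongrightarrow> pmf u j" and e: "e > 0"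
  shows "eventually (\<lambda>k. \<forall>g. unit_bounded g \<longrightarrow>
    \<bar>measure_pmf.expectation (p k) g - measure_pmf.expectation u g\<bar> \<le> e) sequentially"
proof -
  let ?C = "count_space (UNIV :: 'x set)"
  have int: "integrable ?C (pmf r)" for r :: "'x pmf"
    using integrable_pmf_count_space[of "\<lambda>_. 1" 1 r] by simp
  have int1: "(\<integral>x. pmf r x \<partial>?C) = 1" for r :: "'x pmf"
    using expectation_pmf_count_space[of r "\<lambda>_. 1"] by simp
  \<comment> \<open>Applied to the difference of two pmfs, the term \<open>d\<close> integrates to 0
    and only twice the positive part of \<open>-d\<close> is left.\<close>
  have abs_max: "\<bar>d\<bar> = d + 2 * max 0 (- d)" for d :: real
    by (simp add: max_def)
  define P where "P k = (\<integral>x. max 0 (pmf u x - pmf (p k) x) \<partial>?C)" for k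
  have "P \<longlonglongrightarrow> (\<integral>x. 0 \<partial>?C)"
    unfolding P_def
  proof (rule integral_dominated_convergence[where w = "pmf u"])
    show "AE x in ?C. (\<lambda>k. max 0 (pmf u x - pmf (p k) x)) \<longlonglongrightarrow> 0"
    proof (rule AE_I2)
      fix x
      have "(\<lambda>k. max 0 (pmf u x - pmf (p k) x)) \<longlonglongrightarrow> max 0 (pmf u x - pmf u x)"
        by (intro tendsto_intros lim)
      then show "(\<lambda>k. max 0 (pmf u x - pmf (p k) x)) \<longlonglongrightarrow> 0" by simp
    qed
  qed (use int in \<open>auto simp: max_def pmf_nonneg\<close>)
  then have "P \<longlonglongrightarrow> 0" by simp
  then have "eventually (\<lambda>k. P k < e / 2) sequentially"
    using e by (intro order_tendstoD) auto
  then show ?thesis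
  proof eventually_elim
    case (elim k)
    have imax: "integrable ?C (\<lambda>x. max 0 (pmf u x - pmf (p k) x))"
      by (intro integrable_max Bochner_Integration.integrable_diff int) auto
    show ?case
    proof (intro allI impI)
      fix g :: "'x \<Rightarrow> real" assume g: "unit_bounded g"
      have i: "integrable ?C (\<lambda>x. pmf r x * g x)" for r
        by (rule integrable_pmf_count_space) (use g in \<open>auto simp: unit_bounded_def\<close>)
      have "\<bar>measure_pmf.expectation (p k) g - measure_pmf.expectation u g\<bar>
        = \<bar>\<integral>x. (pmf (p k) x - pmf u x) * g x \<partial>?C\<bar>"
        unfolding expectation_pmf_count_space by (simp add: i left_diff_distrib)
      also have "\<dots> \<le> (\<integral>x. \<bar>(pmf (p k) x - pmf u x) * g x\<bar> \<partial>?C)"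
        using integral_norm_bound[of ?C "\<lambda>x. (pmf (p k) x - pmf u x) * g x"] by simp
      also have "\<dots> \<le> (\<integral>x. (pmf (p k) x - pmf u x) + 2 * max 0 (pmf u x - pmf (p k) x) \<partial>?C)"
      proof (rule integral_mono)
        show "integrable ?C (\<lambda>x. \<bar>(pmf (p k) x - pmf u x) * g x\<bar>)"
          using i by (simp add: left_diff_distrib)
        show "integrable ?C (\<lambda>x. (pmf (p k) x - pmf u x) + 2 * max 0 (pmf u x - pmf (p k) x))"
          using int imax by auto
        fix x
        have "\<bar>(pmf (p k) x - pmf u x) * g x\<bar> \<le> \<bar>pmf (p k) x - pmf u x\<bar> * 1"
          unfolding abs_mult by (rule mult_left_mono) (use unit_boundedD[OF g] in auto)
        then show "\<bar>(pmf (p k) x - pmf u x) * g x\<bar>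
            \<le> (pmf (p k) x - pmf u x) + 2 * max 0 (pmf u x - pmf (p k) x)"
          using abs_max[of "pmf (p k) x - pmf u x"] by simp
      qed
      also have "\<dots> = 2 * P k"
        unfolding P_def using int imax int1 by simp
      finally show "\<bar>measure_pmf.expectation (p k) g - measure_pmf.expectation u g\<bar> \<le> e"
        using elim by simp
    qed
  qed
qed

text \<open>First-order Taylor expansion with an explicit remainder. It is used with
  \<open>y\<close> of order \<open>1/n\<close>, so the remainder is of order \<open>1/n^2\<close>.
  The constant comes from \<open>r^2 + r \<le> (r + 1)^2\<close>.\<close>

lemma power_add_expansion_error:
  fixes x y :: real
  assumes "\<bar>x\<bar> \<le> 1" "\<bar>x + y\<bar> \<le> 1"
  shows "\<bar>(x + y) ^ r - x ^ r - real r * x ^ (r - 1) * y\<bar> \<le> (real r)\<^sup>2 * y\<^sup>2"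
proof (induction r)
  case (Suc r)
  let ?e = "\<lambda>r. (x + y) ^ r - x ^ r - real r * x ^ (r - 1) * y"
  have "?e (Suc r) = (x + y) * ?e r + real r * x ^ (r - 1) * y\<^sup>2"
    by (cases r) (auto simp: algebra_simps power2_eq_square)
  then have "\<bar>?e (Suc r)\<bar> \<le> \<bar>x + y\<bar> * \<bar>?e r\<bar> + real r * \<bar>x\<bar> ^ (r - 1) * y\<^sup>2"
    by (metis (no_types, opaque_lifting) abs_triangle_ineq abs_mult power_abs abs_of_nat abs_power2)
  also have "\<dots> \<le> 1 * ((real r)\<^sup>2 * y\<^sup>2) + real r * 1 * y\<^sup>2"
    using assms Suc by (intro add_mono mult_mono power_le_one) auto
  also have "\<dots> = ((real r)\<^sup>2 + real r) * y\<^sup>2"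
    by (simp add: algebra_simps)
  also have "\<dots> \<le> (real (Suc r))\<^sup>2 * y\<^sup>2"
    by (rule mult_right_mono) (simp_all add: power2_eq_square algebra_simps)
  finally show ?case .
qed simp

text \<open>\<open>K n\<close> written as a perturbation of the identity along one fixed kernel
  \<open>q\<close>, which will be \<open>Q'\<close>. The step sizes up to \<open>m\<close> are left
  free, as they concern finitely many steps.\<close>

locale inhomogeneous_chain =
  fixes M :: "'a measure" and T :: "nat \<Rightarrow> 'a \<Rightarrow> 'x::countable" and \<pi> :: "'x \<Rightarrow> real"
    and q :: "'x \<Rightarrow> 'x pmf" and a :: "nat \<Rightarrow> real" and \<kappa> :: "nat \<Rightarrow> 'x \<Rightarrow> 'x pmf"
    and \<theta> :: real and m :: nat
  assumes prob: "prob_space M"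
    and chain: "markov_chain M T \<pi> (\<lambda>n i j. pmf (\<kappa> n i) j)"
    and \<kappa>: "\<And>n i j. pmf (\<kappa> n i) j = idm i j + a n * (pmf (q i) j - idm i j)"
    and a: "\<And>n. n > m \<Longrightarrow> a n = \<theta> / real n"
    and \<theta>: "\<theta> > 0"
begin

interpretation M: prob_space M by (rule prob)

section \<open>One step of the chain\<close>

lemma measurable_T [measurable]: "T j \<in> measurable M (count_space UNIV)"
  using chain by (auto simp: markov_chain_def)

text \<open>Obtained by linearity of the integral: with \<open>1 - a n\<close> possibly negative,
  \<open>\<kappa> n i\<close> cannot be treated as a mixture of \<open>return_pmf i\<close> and
  \<open>q i\<close>.\<close>

lemma kernel_app_\<kappa>:
  assumes bd: "\<And>x. \<bar>f x\<bar> \<le> B"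
  shows "kernel_app (\<kappa> n) f i = f i + a n * (kernel_app q f i - f i)"
proof -
  let ?C = "count_space (UNIV :: 'x set)"
  have i: "integrable ?C (\<lambda>x. pmf r x * f x)" for r
    by (rule integrable_pmf_count_space[OF bd])
  have idm: "idm i j = pmf (return_pmf i) j" for j
    by (simp add: idm_def indicator_def)
  have "kernel_app (\<kappa> n) f i = (\<integral>x. pmf (return_pmf i) x * f x
      + a n * (pmf (q i) x * f x - pmf (return_pmf i) x * f x) \<partial>?C)"
    unfolding kernel_app_def expectation_pmf_count_space \<kappa> idm
    by (intro Bochner_Integration.integral_cong) (auto simp: algebra_simps)
  also have "\<dots> = measure_pmf.expectation (return_pmf i) f
      + a n * (kernel_app q f i - measure_pmf.expectation (return_pmf i) f)"
    unfolding kernel_app_def expectation_pmf_count_space by (simp add: i del: pmf_return)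
  finally show ?thesis by simp
qed

definition avg :: "('x \<Rightarrow> real) \<Rightarrow> nat \<Rightarrow> 'a \<Rightarrow> real" where
  "avg h n \<omega> = (\<Sum>j\<in>{1..n}. h (T j \<omega>)) / real n"

lemma measurable_avg [measurable]: "avg h n \<in> borel_measurable M"
  unfolding avg_def by measurable

lemma avg_abs_le: "unit_bounded h \<Longrightarrow> \<bar>avg h n \<omega>\<bar> \<le> 1"
proof -
  assume h: "unit_bounded h"
  have "\<bar>\<Sum>j\<in>{1..n}. h (T j \<omega>)\<bar> \<le> (\<Sum>j\<in>{1..n}. 1)"
    by (rule order_trans[OF sum_abs]) (intro sum_mono unit_boundedD h)
  then show ?thesis by (cases "n = 0") (auto simp: avg_def field_simps)
qed

lemma avg_step:
  assumes h: "unit_bounded h" and n: "n \<ge> 1" and bd: "\<And>x. \<bar>f x\<bar> \<le> B"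
  shows "(\<integral>\<omega>. avg h n \<omega> ^ r * f (T (Suc n) \<omega>) \<partial>M) = (\<integral>\<omega>. avg h n \<omega> ^ r * kernel_app (\<kappa> n) f (T n \<omega>) \<partial>M)"
proof -
  \<comment> \<open>The cutoff at length \<open>n\<close> bounds \<open>c\<close> by 1 on all lists,
    as the step lemma demands, without changing it on actual paths.\<close>
  define c where "c z = (if length z = n then (sum_list (map h z) / real n) ^ r else 0)" for z :: "'x list"
  have avg: "avg h n \<omega> ^ r = c (map (\<lambda>k. T k \<omega>) [1..<Suc n])" for \<omega>
    by (simp add: c_def avg_def comp_def interv_sum_list_conv_sum_set_nat atLeastLessThanSuc_atLeastAtMost
        flip: map_map del: upt_Suc) (simp add: comp_def interv_sum_list_conv_sum_set_nat atLeastLessThanSuc_atLeastAtMost del: upt_Suc)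
  have c1: "\<bar>c z\<bar> \<le> 1" for z
  proof -
    have "\<bar>sum_list (map h z)\<bar> \<le> real (length z)"
    proof (induction z)
      case (Cons x z)
      then show ?case using unit_boundedD[OF h, of x] by simp
    qed simp
    then have "length z = n \<Longrightarrow> \<bar>sum_list (map h z) / real n\<bar> \<le> 1" using n by (auto simp: field_simps)
    then show ?thesis unfolding c_def by (auto simp: power_abs intro!: power_le_one)
  qed
  have B: "B \<ge> 0" using bd[of undefined] by linarith
  have "\<bar>c z * f y\<bar> \<le> 1 * B" for z y
    unfolding abs_mult by (intro mult_mono c1 bd) (use B in auto)
  then have "(\<integral>\<omega>. c (map (\<lambda>k. T k \<omega>) [1..<Suc n]) * f (T (Suc n) \<omega>) \<partial>M)
    = (\<integral>\<omega>. measure_pmf.expectation (\<kappa> n (T n \<omega>)) (\<lambda>y. c (map (\<lambda>k. T k \<omega>) [1..<Suc n]) * f y) \<partial>M)"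
    by (intro markov_chain_step_expectation[where F = "\<lambda>z y. c z * f y", OF prob chain n]) auto
  then show ?thesis unfolding avg kernel_app_def by simp
qed

lemma integrable_avg:
  assumes h: "unit_bounded h" and bd: "\<And>x. \<bar>f x\<bar> \<le> B"
  shows "integrable M (\<lambda>\<omega>. avg h n \<omega> ^ r * f (T k \<omega>))"
proof (rule M.integrable_const_bound[where B = B])
  have "\<bar>avg h n \<omega> ^ r * f (T k \<omega>)\<bar> \<le> 1 * B" for \<omega>
    unfolding abs_mult by (rule mult_mono) (use avg_abs_le[OF h] bd in \<open>auto simp: power_abs intro: power_le_one\<close>)
  then show "AE \<omega> in M. norm (avg h n \<omega> ^ r * f (T k \<omega>)) \<le> B" by simp
qed measurable

text \<open>The case \<open>h = 0\<close>, \<open>r = 0\<close>, where \<open>0 ^ 0 = 1\<close>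
  removes the average.\<close>

lemma integrable_T:
  fixes f :: "'x \<Rightarrow> real"
  assumes bd: "\<And>x. \<bar>f x\<bar> \<le> B"
  shows "integrable M (\<lambda>\<omega>. f (T k \<omega>))"
  using integrable_avg[of "\<lambda>_. 0" f B 0 0 k, OF _ bd] by (simp add: unit_bounded_def)

lemma T_step:
  assumes n: "n \<ge> 1" and bd: "\<And>x. \<bar>f x\<bar> \<le> B"
  shows "(\<integral>\<omega>. f (T (Suc n) \<omega>) \<partial>M) = (\<integral>\<omega>. kernel_app (\<kappa> n) f (T n \<omega>) \<partial>M)"
  using avg_step[of "\<lambda>_. 0" n f B 0, OF _ n bd] by (simp add: unit_bounded_def)

text \<open>A bound \<open>e\<close> on the dual norm distance between the functional
  \<open>L\<close> and the moment functional after \<open>n\<close> steps. The extra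
  \<open>k\<close> applications of \<open>q\<close> serve the case \<open>r = 0\<close>; there
  \<open>h\<close> is irrelevant and is set to 0.\<close>

definition mean_dist :: "('x \<Rightarrow> real) \<Rightarrow> nat \<Rightarrow> (('x \<Rightarrow> real) \<Rightarrow> real) \<Rightarrow> nat \<Rightarrow> nat \<Rightarrow> real \<Rightarrow> bool" where
  "mean_dist h r L n k e \<longleftrightarrow> (\<forall>g. unit_bounded g \<longrightarrow>
     \<bar>(\<integral>\<omega>. avg h n \<omega> ^ r * (kernel_app q ^^ k) g (T n \<omega>) \<partial>M) - L g\<bar> \<le> e)"

text \<open>The bound \<open>e + C (n1/n)^a 2^(-k)\<close>, \<open>a = \<theta>/2\<close>, on the distance after \<open>k\<close> further
  applications of \<open>q\<close> is preserved by one step of the chain, because the fraction \<open>\<theta>/n\<close> of the mass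
  that jumps gains a factor 1/2.\<close>

lemma T_tendsto:
  assumes init: "\<And>e. e > 0 \<Longrightarrow> eventually (\<lambda>k. mean_dist (\<lambda>_. 0) 0 L 1 k e) sequentially"
    and Lbd: "\<And>g. unit_bounded g \<Longrightarrow> \<bar>L g\<bar> \<le> 1" and e: "e > 0"
  shows "eventually (\<lambda>n. mean_dist (\<lambda>_. 0) 0 L n 0 e) sequentially"
proof -
  define d where "d n k e \<longleftrightarrow> mean_dist (\<lambda>_. 0) 0 L n k e" for n k e
  have unit: "unit_bounded ((kernel_app q ^^ k) g)" if "unit_bounded g" for k g
    using that by (induction k) (auto intro: unit_bounded_kernel_app)
  \<comment> \<open>Absolute values are necessary: \<open>a n \<le> 1\<close> is guaranteed only
    from \<open>n \<ge> \<theta>\<close> on.\<close>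
  have step: "d (Suc n) k (\<bar>1 - a n\<bar> * e1 + \<bar>a n\<bar> * e2)"
    if n: "n \<ge> 1" and d1: "d n k e1" and d2: "d n (Suc k) e2" for n k e1 e2
    unfolding d_def mean_dist_def
  proof (intro allI impI)
    fix g :: "'x \<Rightarrow> real" assume g: "unit_bounded g"
    let ?f = "(kernel_app q ^^ k) g" and ?f' = "(kernel_app q ^^ Suc k) g"
    have bd: "\<And>x. \<bar>?f x\<bar> \<le> 1" "\<And>x. \<bar>?f' x\<bar> \<le> 1" using unit[OF g] by (auto intro: unit_boundedD simp del: funpow.simps)
    have i: "integrable M (\<lambda>\<omega>. ?f (T n \<omega>))" "integrable M (\<lambda>\<omega>. ?f' (T n \<omega>))"
      by (rule integrable_T[OF bd(1)], rule integrable_T[OF bd(2)])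
    have "(\<integral>\<omega>. ?f (T (Suc n) \<omega>) \<partial>M) = (\<integral>\<omega>. (1 - a n) * ?f (T n \<omega>) + a n * ?f' (T n \<omega>) \<partial>M)"
      unfolding T_step[of n ?f 1, OF n bd(1)] kernel_app_\<kappa>[of ?f 1, OF bd(1)]
      by (intro Bochner_Integration.integral_cong) (auto simp: algebra_simps)
    also have "\<dots> = (1 - a n) * (\<integral>\<omega>. ?f (T n \<omega>) \<partial>M) + a n * (\<integral>\<omega>. ?f' (T n \<omega>) \<partial>M)"
      using i by simp
    finally have "(\<integral>\<omega>. ?f (T (Suc n) \<omega>) \<partial>M) - L g
        = (1 - a n) * ((\<integral>\<omega>. ?f (T n \<omega>) \<partial>M) - L g) + a n * ((\<integral>\<omega>. ?f' (T n \<omega>) \<partial>M) - L g)"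
      by (simp add: algebra_simps)
    also have "\<bar>\<dots>\<bar> \<le> \<bar>1 - a n\<bar> * \<bar>(\<integral>\<omega>. ?f (T n \<omega>) \<partial>M) - L g\<bar> + \<bar>a n\<bar> * \<bar>(\<integral>\<omega>. ?f' (T n \<omega>) \<partial>M) - L g\<bar>"
      unfolding abs_mult[symmetric] by (rule abs_triangle_ineq)
    also have "\<dots> \<le> \<bar>1 - a n\<bar> * e1 + \<bar>a n\<bar> * e2"
    proof -
      have "\<bar>(\<integral>\<omega>. ?f (T n \<omega>) \<partial>M) - L g\<bar> \<le> e1" "\<bar>(\<integral>\<omega>. ?f' (T n \<omega>) \<partial>M) - L g\<bar> \<le> e2"
        using d1[unfolded d_def mean_dist_def, rule_format, OF g] d2[unfolded d_def mean_dist_def, rule_format, OF g]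
        by simp_all
      then show ?thesis by (intro add_mono mult_left_mono abs_ge_zero)
    qed
    finally show "\<bar>(\<integral>\<omega>. avg (\<lambda>_. 0) (Suc n) \<omega> ^ 0 * ?f (T (Suc n) \<omega>) \<partial>M) - L g\<bar>
        \<le> \<bar>1 - a n\<bar> * e1 + \<bar>a n\<bar> * e2" by simp
  qed
  have mono: "d n k e2" if "d n k e1" "e1 \<le> e2" for n k e1 e2
    using that unfolding d_def mean_dist_def by (meson order_trans)
  have d2: "d n k 2" for n k
    unfolding d_def mean_dist_def
  proof (intro allI impI)
    fix g :: "'x \<Rightarrow> real" assume g: "unit_bounded g"
    have "\<bar>\<integral>\<omega>. (kernel_app q ^^ k) g (T n \<omega>) \<partial>M\<bar> \<le> 1"
      by (rule M.abs_expectation_le) (use unit[OF g] in \<open>auto intro: unit_boundedD\<close>)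
    then show "\<bar>(\<integral>\<omega>. avg (\<lambda>_. 0) n \<omega> ^ 0 * (kernel_app q ^^ k) g (T n \<omega>) \<partial>M) - L g\<bar> \<le> 2"
      using Lbd[OF g] by simp
  qed
  \<comment> \<open>Each step preserves convergence in \<open>k\<close> after rescaling
    \<open>e\<close>. This carries it over the finitely many steps up to \<open>n1\<close>, where no
    contraction is available.\<close>
  have conv: "eventually (\<lambda>k. d n k e) sequentially" if "n \<ge> 1" "e > 0" for n e
    using that
  proof (induction n arbitrary: e rule: nat_induct_at_least)
    case base
    then show ?case using init unfolding d_def by simp
  next
    case (Suc n)
    let ?e = "e / (\<bar>1 - a n\<bar> + \<bar>a n\<bar>)"
    have pos: "\<bar>1 - a n\<bar> + \<bar>a n\<bar> > 0" by linarith
    then have "?e > 0" using Suc by simp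
    from Suc.IH[OF this] have "eventually (\<lambda>k. d n k ?e) sequentially" .
    moreover from this have "eventually (\<lambda>k. d n (Suc k) ?e) sequentially"
      by (rule eventually_sequentially_Suc[THEN iffD2])
    ultimately show ?case
    proof eventually_elim
      case (elim k)
      have "\<bar>1 - a n\<bar> * ?e + \<bar>a n\<bar> * ?e = e"
      proof -
        have "c * (e / c) = e" if "c > 0" for c :: real using that by simp
        from this[OF pos] show ?thesis by (simp only: distrib_right)
      qed
      with step[OF Suc.hyps elim] show ?case by simp
    qed
  qed
  \<comment> \<open>Beyond both \<open>m\<close> and \<open>\<theta>\<close>, so that
    \<open>a n = \<theta> / n\<close> lies in \<open>[0, 1]\<close> and staying and jumping do form
    a mixture.\<close>
  define n1 where "n1 = max (Suc m) (nat \<lceil>\<theta>\<rceil>)"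
  have n1: "n1 \<ge> 1" "n1 > m" "real n1 \<ge> \<theta>" unfolding n1_def by (auto simp: le_max_iff_disj) linarith
  obtain k0 where k0: "\<And>k. k \<ge> k0 \<Longrightarrow> d n1 k (e / 2)"
    using conv[OF n1(1), of "e / 2"] e by (auto simp: eventually_sequentially)
  \<comment> \<open>Makes the second term of the bound at \<open>n1\<close> equal to
    \<open>2 * 2^(k0 - k)\<close>, which covers the trivial bound 2 for every
    \<open>k < k0\<close>.\<close>
  define C where "C = 2 * 2 ^ k0 * real n1 powr (\<theta> / 2)"
  have C: "C > 0" unfolding C_def using n1 by simp
  have main: "\<forall>k. d n k (e / 2 + C * real n powr - (\<theta> / 2) * (1 / 2) ^ k)" if "n \<ge> n1" for n
    using that
  proof (induction n rule: nat_induct_at_least)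
    case base
    have Cn: "C * real n1 powr - (\<theta> / 2) = 2 * 2 ^ k0" unfolding C_def using n1
      by (simp add: powr_minus field_simps)
    show ?case
    proof
      fix k show "d n1 k (e / 2 + C * real n1 powr - (\<theta> / 2) * (1 / 2) ^ k)"
      proof (cases "k \<ge> k0")
        case True
        show ?thesis by (rule mono[OF k0[OF True]]) (use C in auto)
      next
        case False
        then have "(2::real) ^ k \<le> 2 ^ k0" by (intro power_increasing) auto
        then have "(1::real) \<le> 2 ^ k0 * (1 / 2) ^ k" by (simp add: power_divide)
        then show ?thesis unfolding Cn by (intro mono[OF d2]) (use e in simp)
      qed
    qed
  next
    case (Suc n)
    have n: "n \<ge> 1" "n > m" "real n \<ge> \<theta>" using Suc.hyps n1 by auto
    have an: "a n = \<theta> / n" "a n \<ge> 0" "a n \<le> 1" using n \<theta> by (auto simp: a)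
    \<comment> \<open>\<open>1 - a n / 2\<close> is \<open>(1 - a n) + a n * (1 / 2)\<close>:
      staying keeps \<open>k\<close>, jumping raises it by one. The power \<open>-\<theta>/2\<close>
      matches this decay because \<open>1 - x \<le> exp (- x)\<close> and
      \<open>ln (1 + 1 / n) \<le> 1 / n\<close>.\<close>
    have exp: "(1 - a n / 2) * real n powr - (\<theta> / 2) \<le> real (Suc n) powr - (\<theta> / 2)"
    proof -
      have "1 - a n / 2 \<le> exp (- (\<theta> / 2 * (1 / n)))"
        using exp_ge_add_one_self[of "- (\<theta> / 2 * (1 / n))"] an by simp
      also have "\<dots> \<le> exp (- (\<theta> / 2 * ln (1 + 1 / n)))"
        using \<theta> by (intro iffD2[OF exp_le_cancel_iff] le_imp_neg_le mult_left_mono ln_add_one_self_le_self) auto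
      also have "\<dots> = (1 + 1 / n) powr - (\<theta> / 2)"
        using n by (simp add: powr_def add_nonneg_eq_0_iff)
      finally have "(1 - a n / 2) * real n powr - (\<theta> / 2) \<le> (1 + 1 / n) powr - (\<theta> / 2) * real n powr - (\<theta> / 2)"
        by (rule mult_right_mono) simp
      also have "\<dots> = ((1 + 1 / n) * real n) powr - (\<theta> / 2)"
        by (rule powr_mult[symmetric])
      also have "(1 + 1 / n) * real n = real (Suc n)" using n by (simp add: field_simps)
      finally show ?thesis .
    qed
    show ?case
    proof
      fix k
      let ?x = "C * real n powr - (\<theta> / 2)"
      have s1: "d (Suc n) k (\<bar>1 - a n\<bar> * (e / 2 + ?x * (1 / 2) ^ k) + \<bar>a n\<bar> * (e / 2 + ?x * (1 / 2) ^ Suc k))"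
        by (rule step[OF n(1) spec[OF Suc.IH] spec[OF Suc.IH]])
      have s2: "\<bar>1 - a n\<bar> * (e / 2 + ?x * (1 / 2) ^ k) + \<bar>a n\<bar> * (e / 2 + ?x * (1 / 2) ^ Suc k)
        = e / 2 + C * ((1 - a n / 2) * real n powr - (\<theta> / 2)) * (1 / 2) ^ k"
      proof -
        have abs: "\<bar>a n\<bar> = a n" "\<bar>1 - a n\<bar> = 1 - a n" using an(2,3) by auto
        show ?thesis unfolding abs by (simp add: field_simps)
      qed
      have s3: "e / 2 + C * ((1 - a n / 2) * real n powr - (\<theta> / 2)) * (1 / 2) ^ k
        \<le> e / 2 + C * real (Suc n) powr - (\<theta> / 2) * (1 / 2) ^ k"
        using exp C by (intro add_left_mono mult_right_mono mult_left_mono) auto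
      show "d (Suc n) k (e / 2 + C * real (Suc n) powr - (\<theta> / 2) * (1 / 2) ^ k)"
        by (rule mono[OF s1[unfolded s2] s3])
    qed
  qed
  have "(\<lambda>n. C * real n powr - (\<theta> / 2)) \<longlonglongrightarrow> C * 0"
    using \<theta> by (intro tendsto_mult tendsto_const tendsto_neg_powr filterlim_real_sequentially) auto
  then have "eventually (\<lambda>n. C * real n powr - (\<theta> / 2) < e / 2) sequentially"
    using e by (intro order_tendstoD) auto
  then show ?thesis
    using eventually_ge_at_top[of n1]
  proof eventually_elim
    case (elim n)
    from main[OF elim(2)] have "d n 0 (e / 2 + C * real n powr - (\<theta> / 2) * (1 / 2) ^ 0)" by blast
    then show ?case using mono[of n 0 _ e] elim(1) unfolding d_def by simp
  qed
qed

text \<open>Let \<open>d n\<close> be the uniform distance for exponent \<open>r \<ge> 1\<close>.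
  One step gives \<open>d (n+1) \<le> n/(n+1) * d n + r \<epsilon>/(n+1) + A/n^2\<close>, with
  \<epsilon> the distance already reached for exponent \<open>r - 1\<close>. Hence
  \<open>n * d n\<close> grows by at most \<open>(r+1) \<epsilon>\<close> per step for large
  \<open>n\<close>, and \<open>d n\<close> ends up below any number larger than
  \<open>(r+1) \<epsilon>\<close>.\<close>

lemma avg_moment_tendsto:
  assumes h: "unit_bounded h"
    and L0: "\<And>e. e > 0 \<Longrightarrow> eventually (\<lambda>n. mean_dist (\<lambda>_. 0) 0 (L 0) n 0 e) sequentially"
    and Lbd: "\<And>r g. unit_bounded g \<Longrightarrow> \<bar>L r g\<bar> \<le> 1"
    and Llin: "\<And>r f g c. unit_bounded f \<Longrightarrow> unit_bounded g \<Longrightarrow>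
      L r (\<lambda>x. f x + c * (g x - f x)) = L r f + c * (L r g - L r f)"
    and Lrec: "\<And>r g. r \<ge> 1 \<Longrightarrow> unit_bounded g \<Longrightarrow>
      (real r + \<theta>) * L r g = \<theta> * L r (kernel_app q g) + real r * L (r - 1) (\<lambda>x. h x * g x)"
    and e: "e > 0"
  shows "eventually (\<lambda>n. mean_dist h r (L r) n 0 e) sequentially"
  using e
proof (induction r arbitrary: e)
  case 0
  then show ?case using L0[of e] unfolding mean_dist_def by simp
next
  case (Suc s)
  define r where "r = Suc s"
  \<comment> \<open>Then \<open>(r + 1) * \<epsilon> = e / 2\<close>: \<open>r\<close> shares for
    the exponent \<open>r - 1\<close>, one for all second-order errors.\<close>
  define \<epsilon> where "\<epsilon> = e / (2 * real (r + 1))"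
  have \<epsilon>: "\<epsilon> > 0" using Suc.prems by (simp add: \<epsilon>_def)
  \<comment> \<open>Collects the errors of order \<open>1/n^2\<close>: \<open>r^2\<close> from the
    Taylor remainder, \<open>r^2\<close> from Bernoulli's inequality, and
    \<open>2 \<theta> r\<close> from replacing \<open>\<kappa> n\<close> by the identity in the term
    of exponent \<open>s\<close>.\<close>
  define A where "A = 2 * (real r)\<^sup>2 + 2 * \<theta> * real r"
  have A: "A \<ge> 0" using \<theta> by (simp add: A_def)
  have "eventually (\<lambda>n. mean_dist h s (L s) n 0 \<epsilon>) sequentially" by (rule Suc.IH[OF \<epsilon>])
  then obtain n2 where n2: "\<And>n. n \<ge> n2 \<Longrightarrow> mean_dist h s (L s) n 0 \<epsilon>"
    by (auto simp: eventually_sequentially)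
  \<comment> \<open>The third entry ensures
    \<open>A / n^2 \<le> \<epsilon> / (2 n) \<le> \<epsilon> / (n + 1)\<close> from
    \<open>n0\<close> on.\<close>
  define n0 where "n0 = Max {n2, Suc m, nat \<lceil>2 * A / \<epsilon>\<rceil>}"
  have n0: "n0 \<ge> n2" "n0 \<ge> Suc m" "real n0 \<ge> 2 * A / \<epsilon>"
    unfolding n0_def by (auto simp: le_max_iff_disj) linarith
  have dist2: "mean_dist h r (L r) n 0 2" for n
    unfolding mean_dist_def
  proof (intro allI impI)
    fix g :: "'x \<Rightarrow> real" assume g: "unit_bounded g"
    have "\<bar>\<integral>\<omega>. avg h n \<omega> ^ r * g (T n \<omega>) \<partial>M\<bar> \<le> 1"
      by (rule M.abs_expectation_le)
        (use avg_abs_le[OF h] g in \<open>auto simp: abs_mult power_abs unit_bounded_def intro!: mult_le_one power_le_one\<close>)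
    then show "\<bar>(\<integral>\<omega>. avg h n \<omega> ^ r * (kernel_app q ^^ 0) g (T n \<omega>) \<partial>M) - L r g\<bar> \<le> 2"
      using Lbd[OF g, of r] by simp
  qed
  \<comment> \<open>At \<open>n = n0\<close> the first summand is the trivial bound 2; multiplied by
    \<open>n\<close> it stays constant.\<close>
  have main: "mean_dist h r (L r) n 0 (2 * real n0 / real n + real (r + 1) * \<epsilon>)" if "n \<ge> n0" for n
    using that
  proof (induction n rule: nat_induct_at_least)
    case base
    have "2 \<le> 2 * real n0 / real n0 + real (r + 1) * \<epsilon>" using n0 \<epsilon> by simp
    then show ?case using dist2[of n0] unfolding mean_dist_def by (meson order_trans)
  next
    case (Suc n)
    have n: "n \<ge> 1" "n > m" using Suc.hyps n0 by auto
    define x where "x = 2 * real n0 / real n + real (r + 1) * \<epsilon>"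
    define \<rho> where "\<rho> = real n / real (Suc n)"
    have \<rho>: "\<rho> \<ge> 0" "\<rho> \<le> 1" by (auto simp: \<rho>_def)
    have an: "a n = \<theta> / real n" using n by (simp add: a)
    show ?case
      unfolding mean_dist_def
    proof (intro allI impI)
      fix g :: "'x \<Rightarrow> real" assume g: "unit_bounded g"
      define hg where "hg = (\<lambda>x. h x * g x)"
      have hg: "unit_bounded hg" unfolding hg_def by (rule unit_bounded_mult[OF h g])
      note bd = unit_boundedD[OF g] unit_boundedD[OF hg]
      let ?X = "avg h n" and ?T = "T (Suc n)"
      have avg_Suc: "avg h (Suc n) \<omega> = \<rho> * ?X \<omega> + h (?T \<omega>) / real (Suc n)" for \<omega>
        using n by (simp add: avg_def \<rho>_def add_divide_distrib)
      have XT: "\<bar>avg h n \<omega>\<bar> \<le> 1" "\<bar>avg h (Suc n) \<omega>\<bar> \<le> 1" for \<omega> using avg_abs_le[OF h] by auto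
      have \<rho>X: "\<bar>\<rho> * avg h n \<omega>\<bar> \<le> 1" for \<omega>
        unfolding abs_mult by (rule mult_le_one) (use XT \<rho> in auto)
      define E where "E \<omega> = avg h (Suc n) \<omega> ^ r - (\<rho> * ?X \<omega>) ^ r
        - real r * (\<rho> * ?X \<omega>) ^ s * (h (?T \<omega>) / real (Suc n))" for \<omega>
      have E: "\<bar>E \<omega>\<bar> \<le> (real r)\<^sup>2 / (real n)\<^sup>2" for \<omega>
      proof -
        have "\<bar>E \<omega>\<bar> \<le> (real r)\<^sup>2 * (h (?T \<omega>) / real (Suc n))\<^sup>2"
          using power_add_expansion_error[of "\<rho> * ?X \<omega>" "h (?T \<omega>) / real (Suc n)" r] \<rho>X XT(2)[of \<omega>]
          unfolding E_def avg_Suc by (simp add: r_def)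
        also have "\<dots> \<le> (real r)\<^sup>2 * (1 / real n)\<^sup>2"
        proof (intro mult_left_mono iffD1[OF abs_le_square_iff])
          have "\<bar>h (?T \<omega>)\<bar> / real (Suc n) \<le> 1 / real n"
            by (rule frac_le) (use unit_boundedD[OF h] n in auto)
          then show "\<bar>h (?T \<omega>) / real (Suc n)\<bar> \<le> \<bar>1 / real n\<bar>" by simp
        qed auto
        finally show ?thesis by (simp add: power_divide)
      qed
      have [measurable]: "E \<in> borel_measurable M" unfolding E_def by measurable
      have iE: "integrable M (\<lambda>\<omega>. E \<omega> * g (?T \<omega>))"
      proof (rule M.integrable_const_bound)
        show "AE \<omega> in M. norm (E \<omega> * g (?T \<omega>)) \<le> (real r)\<^sup>2 / (real n)\<^sup>2 * 1"
          unfolding real_norm_def abs_mult by (intro AE_I2 mult_mono E bd) auto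
      qed measurable
      have iA: "integrable M (\<lambda>\<omega>. ?X \<omega> ^ r * g (?T \<omega>))" "integrable M (\<lambda>\<omega>. ?X \<omega> ^ s * hg (?T \<omega>))"
        by (rule integrable_avg[OF h bd(1)], rule integrable_avg[OF h bd(2)])
      define b where "b = (\<integral>\<omega>. ?X \<omega> ^ r * kernel_app (\<kappa> n) g (T n \<omega>) \<partial>M)"
      define b' where "b' = (\<integral>\<omega>. ?X \<omega> ^ s * kernel_app (\<kappa> n) hg (T n \<omega>) \<partial>M)"
      define er where "er = (\<integral>\<omega>. E \<omega> * g (?T \<omega>) \<partial>M)"
      have er: "\<bar>er\<bar> \<le> (real r)\<^sup>2 / (real n)\<^sup>2"
        unfolding er_def
      proof (rule M.abs_expectation_le)
        fix \<omega>
        have "\<bar>E \<omega> * g (?T \<omega>)\<bar> \<le> (real r)\<^sup>2 / (real n)\<^sup>2 * 1"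
          unfolding abs_mult by (intro mult_mono E bd) auto
        then show "\<bar>E \<omega> * g (?T \<omega>)\<bar> \<le> (real r)\<^sup>2 / (real n)\<^sup>2" by simp
      qed simp
      \<comment> \<open>Extracts the common factor \<open>\<rho> ^ r\<close> from both leading
        terms.\<close>
      have w: "real r / real (Suc n) * \<rho> ^ s = \<rho> ^ r * (real r / real n)"
        using n by (simp add: \<rho>_def r_def)
      have "(\<integral>\<omega>. avg h (Suc n) \<omega> ^ r * g (?T \<omega>) \<partial>M)
        = (\<integral>\<omega>. \<rho> ^ r * (?X \<omega> ^ r * g (?T \<omega>)) + real r / real (Suc n) * \<rho> ^ s * (?X \<omega> ^ s * hg (?T \<omega>))
            + E \<omega> * g (?T \<omega>) \<partial>M)"
        unfolding E_def hg_def
        by (intro Bochner_Integration.integral_cong) (auto simp: power_mult_distrib algebra_simps)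
      also have "\<dots> = \<rho> ^ r * b + \<rho> ^ r * (real r / real n) * b' + er"
        unfolding w using iA iE
        by (simp add: b_def b'_def er_def avg_step[of h n g 1 r, OF h n(1) bd(1)]
              avg_step[of h n hg 1 s, OF h n(1) bd(2)])
      finally have Eq: "(\<integral>\<omega>. avg h (Suc n) \<omega> ^ r * g (?T \<omega>) \<partial>M)
        = \<rho> ^ r * b + \<rho> ^ r * (real r / real n) * b' + er" .
      have ug: "unit_bounded (kernel_app (\<kappa> n) g)" "unit_bounded (kernel_app (\<kappa> n) hg)"
        using g hg by (auto intro: unit_bounded_kernel_app)
      have bL: "\<bar>b - L r (kernel_app (\<kappa> n) g)\<bar> \<le> x"
        using Suc.IH ug(1) unfolding mean_dist_def b_def x_def by simp
      have b'L: "\<bar>b' - L s (kernel_app (\<kappa> n) hg)\<bar> \<le> \<epsilon>"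
        using n2[of n] Suc.hyps n0(1) ug(2) unfolding mean_dist_def b'_def by simp
      have kg: "kernel_app (\<kappa> n) f = (\<lambda>x. f x + \<theta> / real n * (kernel_app q f x - f x))"
        if "unit_bounded f" for f
        using kernel_app_\<kappa>[OF unit_boundedD[OF that]] an by auto
      \<comment> \<open>The recursion expresses the effect of a jump on \<open>L r\<close> through
        \<open>L s hg\<close>. This cancels the contribution of \<open>b'\<close>, and
        \<open>L r g\<close> is left with the coefficient \<open>\<rho> ^ r * (1 + r / n)\<close>,
        which is 1 up to order \<open>1/n^2\<close>.\<close>
      have Lr: "L r (kernel_app (\<kappa> n) g) = L r g + real r / real n * (L r g - L s hg)"
      proof -
        have "L r (kernel_app (\<kappa> n) g) = L r g + \<theta> / real n * (L r (kernel_app q g) - L r g)"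
          unfolding kg[OF g] by (rule Llin[OF g unit_bounded_kernel_app[OF g]])
        moreover have "\<theta> * (L r (kernel_app q g) - L r g) = real r * (L r g - L s hg)"
          using Lrec[of r g] g by (simp add: r_def hg_def algebra_simps)
        ultimately show ?thesis by (simp add: field_simps)
      qed
      \<comment> \<open>This term already carries a factor \<open>r / n\<close>, so an error of
        order \<open>1/n\<close> is harmless.\<close>
      have Ls: "\<bar>L s (kernel_app (\<kappa> n) hg) - L s hg\<bar> \<le> 2 * \<theta> / real n"
      proof -
        have "L s (kernel_app (\<kappa> n) hg) - L s hg = \<theta> / real n * (L s (kernel_app q hg) - L s hg)"
          unfolding kg[OF hg] Llin[OF hg unit_bounded_kernel_app[OF hg]] by simp
        also have "\<bar>\<dots>\<bar> \<le> \<theta> / real n * 2"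
          unfolding abs_mult using Lbd[OF hg, of s] Lbd[OF unit_bounded_kernel_app[OF hg], of s q] \<theta>
          by (intro mult_mono) auto
        finally show ?thesis by (simp add: mult.commute)
      qed
      have b'L2: "\<bar>b' - L s hg\<bar> \<le> \<epsilon> + 2 * \<theta> / real n" using b'L Ls by linarith
      have \<rho>r: "\<rho> ^ r \<le> 1" "\<rho> ^ r \<ge> 0" using \<rho> by (auto intro: power_le_one)
      \<comment> \<open>Bernoulli twice: for \<open>1 + 1/n\<close>, the inverse of \<rho>, from
        above, and for \<open>\<rho> = 1 - 1/(n+1)\<close> from below.\<close>
      have bern: "\<bar>\<rho> ^ r * (1 + real r / real n) - 1\<bar> \<le> (real r)\<^sup>2 / (real n)\<^sup>2"
      proof -
        have "1 + real r * (1 / real n) \<le> (1 + 1 / real n) ^ r"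
          by (rule Bernoulli_inequality) (use n in \<open>auto intro: order_trans[of _ 0]\<close>)
        then have "\<rho> ^ r * (1 + real r / real n) \<le> \<rho> ^ r * (1 + 1 / real n) ^ r"
          using \<rho>r by (intro mult_left_mono) auto
        also have "\<dots> = 1"
        proof -
          have "1 + 1 / real n = real (Suc n) / real n" using n by (simp add: field_simps)
          then have "\<rho> * (1 + 1 / real n) = 1" using n by (simp add: \<rho>_def del: of_nat_Suc)
          then show ?thesis unfolding power_mult_distrib[symmetric] by simp
        qed
        finally have up: "\<rho> ^ r * (1 + real r / real n) \<le> 1" .
        have "1 + real r * (- (1 / real (Suc n))) \<le> (1 + (- (1 / real (Suc n)))) ^ r"
          by (rule Bernoulli_inequality) simp
        also have "1 + (- (1 / real (Suc n))) = \<rho>" by (simp add: \<rho>_def field_simps)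
        finally have "(1 - real r / real (Suc n)) * (1 + real r / real n) \<le> \<rho> ^ r * (1 + real r / real n)"
          by (intro mult_right_mono) auto
        moreover have "1 - (real r)\<^sup>2 / (real n)\<^sup>2 \<le> (1 - real r / real (Suc n)) * (1 + real r / real n)"
        proof -
          define u v where "u = 1 / real n" and "v = 1 / real (Suc n)"
          have uv: "0 \<le> v" "v \<le> u" using n by (auto simp: u_def v_def intro: frac_le)
          have "u - v = 1 / (real n * real (Suc n))" using n by (simp add: u_def v_def diff_frac_eq)
          then have "u - v = u * v" by (simp add: u_def v_def)
          moreover have "(1 - real r * v) * (1 + real r * u) = 1 + real r * (u - v) - (real r)\<^sup>2 * (u * v)"
            by (simp add: algebra_simps power2_eq_square)
          ultimately have "(1 - real r * v) * (1 + real r * u) = 1 + real r * (u * v) - (real r)\<^sup>2 * (u * v)"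
            by simp
          moreover have "(real r)\<^sup>2 * (u * v) \<le> (real r)\<^sup>2 * (u * u)"
            using uv by (intro mult_left_mono) auto
          moreover have "0 \<le> real r * (u * v)" using uv by (intro mult_nonneg_nonneg) auto
          ultimately have "1 - (real r)\<^sup>2 * (u * u) \<le> (1 - real r * v) * (1 + real r * u)" by linarith
          then show ?thesis by (simp add: u_def v_def power2_eq_square)
        qed
        ultimately show ?thesis using up by linarith
      qed
      have "(\<integral>\<omega>. avg h (Suc n) \<omega> ^ r * g (?T \<omega>) \<partial>M) - L r g
        = \<rho> ^ r * (b - L r (kernel_app (\<kappa> n) g)) + \<rho> ^ r * (real r / real n) * (b' - L s hg)
          + (\<rho> ^ r * (1 + real r / real n) - 1) * L r g + er"
        unfolding Eq Lr by (simp add: algebra_simps diff_divide_distrib)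
      also have "\<bar>\<dots>\<bar> \<le> \<rho> ^ r * x + \<rho> ^ r * (real r / real n) * (\<epsilon> + 2 * \<theta> / real n)
          + (real r)\<^sup>2 / (real n)\<^sup>2 * 1 + (real r)\<^sup>2 / (real n)\<^sup>2"
      proof (intro order_trans[OF abs_triangle_ineq] add_mono er)
        show "\<bar>\<rho> ^ r * (b - L r (kernel_app (\<kappa> n) g))\<bar> \<le> \<rho> ^ r * x"
          unfolding abs_mult using bL \<rho>r by (simp add: mult_left_mono)
        show "\<bar>\<rho> ^ r * (real r / real n) * (b' - L s hg)\<bar> \<le> \<rho> ^ r * (real r / real n) * (\<epsilon> + 2 * \<theta> / real n)"
        proof -
          have "0 \<le> \<rho> ^ r * (real r / real n)" using \<rho>r by simp
          then show ?thesis
            unfolding abs_mult[of "\<rho> ^ r * (real r / real n)"] using b'L2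
            by (simp only: abs_of_nonneg) (rule mult_left_mono)
        qed
        show "\<bar>(\<rho> ^ r * (1 + real r / real n) - 1) * L r g\<bar> \<le> (real r)\<^sup>2 / (real n)\<^sup>2 * 1"
          unfolding abs_mult using bern Lbd[OF g] by (intro mult_mono) auto
      qed
      also have "\<dots> \<le> \<rho> * x + real r * \<epsilon> / real (Suc n) + A / (real n)\<^sup>2"
      proof -
        have x0: "x \<ge> 0" using \<epsilon> by (simp add: x_def)
        have \<rho>s: "\<rho> ^ s \<le> 1" "\<rho> ^ s \<ge> 0" using \<rho> by (auto intro: power_le_one)
        \<comment> \<open>Here \<open>r \<ge> 1\<close> is essential: at least one factor \<rho> of
          contraction remains.\<close>
        have "\<rho> ^ r * x \<le> \<rho> * x"
          using \<rho>s \<rho> x0 by (intro mult_right_mono) (auto simp: r_def mult_left_le)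
        moreover have "\<rho> ^ r * (real r / real n) * \<epsilon> \<le> real r * \<epsilon> / real (Suc n)"
        proof -
          have "real r / real (Suc n) * \<rho> ^ s * \<epsilon> \<le> real r / real (Suc n) * 1 * \<epsilon>"
            using \<rho>s \<epsilon> by (intro mult_right_mono mult_left_mono) auto
          then show ?thesis unfolding w by simp
        qed
        moreover have "\<rho> ^ r * ((real r / real n) * (2 * \<theta> / real n)) \<le> (real r / real n) * (2 * \<theta> / real n)"
          using \<rho>r \<theta> by (intro mult_left_le_one_le) auto
        moreover have "(real r / real n) * (2 * \<theta> / real n) + (real r)\<^sup>2 / (real n)\<^sup>2 + (real r)\<^sup>2 / (real n)\<^sup>2 = A / (real n)\<^sup>2"
          unfolding A_def by (simp add: power2_eq_square add_divide_distrib mult_ac)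
        moreover have "\<rho> ^ r * (real r / real n) * (\<epsilon> + 2 * \<theta> / real n)
          = \<rho> ^ r * (real r / real n) * \<epsilon> + \<rho> ^ r * ((real r / real n) * (2 * \<theta> / real n))"
          by (simp only: distrib_left mult.assoc)
        ultimately show ?thesis by linarith
      qed
      also have "A / (real n)\<^sup>2 \<le> \<epsilon> / real (Suc n)"
      proof -
        have "2 * A / \<epsilon> \<le> real n" using n0(3) Suc.hyps by simp
        then have "2 * A \<le> real n * \<epsilon>" using \<epsilon> by (simp add: field_simps)
        then have "2 * A * real n \<le> real n * \<epsilon> * real n" using n by (intro mult_right_mono) auto
        moreover have "A * real (Suc n) \<le> A * (2 * real n)" using n A by (intro mult_left_mono) auto
        ultimately have "A * real (Suc n) \<le> \<epsilon> * (real n)\<^sup>2"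
          by (simp add: power2_eq_square mult_ac)
        then have "A \<le> \<epsilon> * (real n)\<^sup>2 / real (Suc n)"
          by (intro mult_imp_le_div_pos) auto
        then show ?thesis using n by (intro mult_imp_div_pos_le) auto
      qed
      finally have "\<bar>(\<integral>\<omega>. avg h (Suc n) \<omega> ^ r * g (?T \<omega>) \<partial>M) - L r g\<bar>
        \<le> \<rho> * x + real r * \<epsilon> / real (Suc n) + \<epsilon> / real (Suc n)" by simp
      also have "\<dots> = 2 * real n0 / real (Suc n) + real (r + 1) * \<epsilon>"
      proof -
        have "\<rho> * x = (2 * real n0 + real n * (real (r + 1) * \<epsilon>)) / real (Suc n)"
        proof -
          have "real n * x = 2 * real n0 + real n * (real (r + 1) * \<epsilon>)"
            using n by (simp add: x_def distrib_left)
          moreover have "\<rho> * x = real n * x / real (Suc n)" by (simp add: \<rho>_def)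
          ultimately show ?thesis by (simp only:)
        qed
        then have "\<rho> * x + real r * \<epsilon> / real (Suc n) + \<epsilon> / real (Suc n)
          = (2 * real n0 + real n * (real (r + 1) * \<epsilon>) + real r * \<epsilon> + \<epsilon>) / real (Suc n)"
          by (simp add: add_divide_distrib)
        also have "2 * real n0 + real n * (real (r + 1) * \<epsilon>) + real r * \<epsilon> + \<epsilon>
          = 2 * real n0 + real (Suc n) * (real (r + 1) * \<epsilon>)"
          by (simp add: algebra_simps)
        finally show ?thesis by (simp add: add_divide_distrib)
      qed
      finally show "\<bar>(\<integral>\<omega>. avg h (Suc n) \<omega> ^ r * (kernel_app q ^^ 0) g (T (Suc n) \<omega>) \<partial>M) - L r g\<bar>
        \<le> 2 * real n0 / real (Suc n) + real (r + 1) * \<epsilon>" by simp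
    qed
  qed
  have "(\<lambda>n. 2 * real n0 / real n) \<longlonglongrightarrow> 0"
    by (rule lim_const_over_n)
  then have "eventually (\<lambda>n. 2 * real n0 / real n < e / 2) sequentially"
    using Suc.prems by (intro order_tendstoD) auto
  then show ?case
    using eventually_ge_at_top[of n0]
  proof eventually_elim
    case (elim n)
    have "real (r + 1) * \<epsilon> = e / 2" unfolding \<epsilon>_def by (simp del: of_nat_add of_nat_Suc)
    then have "2 * real n0 / real n + real (r + 1) * \<epsilon> \<le> e" using elim(1) by simp
    then show ?case using main[OF elim(2)] unfolding mean_dist_def r_def by (meson order_trans)
  qed
qed

end

section \<open>Moments of the stick-breaking measure\<close>

lemma beta_density_eq:
  "beta_density a b = (\<lambda>x. ennreal (if 0 < x \<and> x < 1 then x powr (a - 1) * (1 - x) powr (b - 1) / Beta a b else 0))"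
  by (auto simp: beta_density_def)

text \<open>The Beta integral is available as a gauge integral on the closed interval; nonnegativity
  makes it absolutely integrable, hence a Lebesgue integral.\<close>

lemma beta_integral:
  fixes \<alpha> \<beta> :: real
  assumes "\<alpha> > 0" "\<beta> > 0"
  shows "(\<integral>x. (if 0 < x \<and> x < 1 then x powr (\<alpha> - 1) * (1 - x) powr (\<beta> - 1) else 0) \<partial>lborel) = Beta \<alpha> \<beta>"
proof -
  let ?g = "\<lambda>x::real. x powr (\<alpha> - 1) * (1 - x) powr (\<beta> - 1)"
  have hi: "(?g has_integral Beta \<alpha> \<beta>) {0<..<1}"
    using has_integral_Beta_real[OF assms] by (simp add: has_integral_Icc_iff_Ioo)
  have abs: "?g absolutely_integrable_on {0<..<1}"
    by (rule nonnegative_absolutely_integrable_1) (use hi in \<open>auto simp: integrable_on_def\<close>)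
  have "Beta \<alpha> \<beta> = integral {0<..<1} ?g" using hi by (simp add: integral_unique)
  also have "\<dots> = (LINT x:{0<..<1}|lebesgue. ?g x)"
    by (rule set_lebesgue_integral_eq_integral(2)[OF abs, symmetric])
  also have "\<dots> = (LINT x:{0<..<1}|lborel. ?g x)"
    unfolding set_lebesgue_integral_def by (rule integral_completion) measurable
  also have "\<dots> = (\<integral>x. (if 0 < x \<and> x < 1 then ?g x else 0) \<partial>lborel)"
    unfolding set_lebesgue_integral_def
    by (intro Bochner_Integration.integral_cong) (auto simp: indicator_def)
  finally show ?thesis by simp
qed

lemma beta_distributed_moment:
  assumes "distributed N lborel Y (beta_density 1 \<theta>)" "\<theta> > 0"
  shows "(\<integral>\<omega>. Y \<omega> ^ a * (1 - Y \<omega>) ^ b \<partial>N) = Beta (real a + 1) (real b + \<theta>) / Beta 1 \<theta>"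
proof -
  define d :: "real \<Rightarrow> real" where
    "d x = (if 0 < x \<and> x < 1 then x powr (1 - 1) * (1 - x) powr (\<theta> - 1) / Beta 1 \<theta> else 0)" for x
  have B: "Beta 1 \<theta> > 0" unfolding Beta_def using assms(2)
    by (intro divide_pos_pos mult_pos_pos Gamma_real_pos) auto
  have "(\<integral>\<omega>. Y \<omega> ^ a * (1 - Y \<omega>) ^ b \<partial>N) = (\<integral>x. d x * (x ^ a * (1 - x) ^ b) \<partial>lborel)"
    by (rule distributed_integral[symmetric])
      (use assms B in \<open>auto simp: d_def beta_density_eq zero_le_divide_iff\<close>)
  also have "\<dots> = (\<integral>x. (if 0 < x \<and> x < 1 then x powr ((real a + 1) - 1) * (1 - x) powr ((real b + \<theta>) - 1) else 0)
      / Beta 1 \<theta> \<partial>lborel)"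
  proof (intro Bochner_Integration.integral_cong refl)
    fix x :: real
    have "(1 - x) powr (real b + \<theta> - 1) = (1 - x) ^ b * (1 - x) powr (\<theta> - 1)" if "x < 1"
    proof -
      have "(1 - x) powr (real b + \<theta> - 1) = (1 - x) powr real b * (1 - x) powr (\<theta> - 1)"
        by (simp add: powr_add[symmetric] add_diff_eq)
      then show ?thesis using that by (simp add: powr_realpow)
    qed
    then show "d x * (x ^ a * (1 - x) ^ b)
      = (if 0 < x \<and> x < 1 then x powr ((real a + 1) - 1) * (1 - x) powr ((real b + \<theta>) - 1) else 0) / Beta 1 \<theta>"
      by (simp add: d_def powr_realpow mult_ac)
  qed
  also have "\<dots> = Beta (real a + 1) (real b + \<theta>) / Beta 1 \<theta>"
    using beta_integral[of "real a + 1" "real b + \<theta>"] assms(2) by simp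
  finally show ?thesis .
qed

lemma (in prob_space) beta_distributed_AE:
  assumes "distributed M lborel Y (beta_density a b)"
  shows "AE \<omega> in M. 0 < Y \<omega> \<and> Y \<omega> < 1"
proof -
  have Y[measurable]: "Y \<in> borel_measurable M" using distributed_measurable[OF assms] by simp
  have "emeasure M (Y -` (- {0<..<1}) \<inter> space M) = (\<integral>\<^sup>+x. beta_density a b x * indicator (- {0<..<1}) x \<partial>lborel)"
    by (rule distributed_emeasure[OF assms]) auto
  also have "\<dots> = (\<integral>\<^sup>+x. 0 \<partial>(lborel :: real measure))"
    by (intro nn_integral_cong) (auto simp: beta_density_def indicator_def)
  finally have "emeasure M (Y -` (- {0<..<1}) \<inter> space M) = 0" by simp
  moreover have "Y -` (- {0<..<1}) \<inter> space M \<in> sets M"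
    by (rule measurable_sets[OF Y]) auto
  ultimately show ?thesis
    by (intro AE_I[of _ _ "Y -` (- {0<..<1}) \<inter> space M"]) auto
qed

text \<open>For \<open>s \<le> r\<close> this is \<open>(r choose s) * E[X^(r-s) (1-X)^s]\<close>
  with \<open>X\<close> Beta distributed with parameters 1 and \<theta>. In the Gamma form the
  factor \<open>(r-s)!\<close> has cancelled and the dependence on \<open>r\<close> and on
  \<open>s\<close> separates.\<close>

definition stick_coeff :: "real \<Rightarrow> nat \<Rightarrow> nat \<Rightarrow> real" where
  "stick_coeff \<theta> r s = \<theta> * (fact r / fact s) * (Gamma (real s + \<theta>) / Gamma (real r + 1 + \<theta>))"

lemma Gamma_real_plus1: "x > 0 \<Longrightarrow> Gamma (x + 1) = x * Gamma x" for x :: real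
  by (rule Gamma_plus1) (auto simp: nonpos_Ints_def)

lemma Beta_stick_coeff:
  assumes "\<theta> > 0" "s \<le> r"
  shows "real (r choose s) * (Beta (real (r - s) + 1) (real s + \<theta>) / Beta 1 \<theta>) = stick_coeff \<theta> r s"
proof -
  have G: "Gamma \<theta> \<noteq> 0" "Gamma (1 + \<theta>) = \<theta> * Gamma \<theta>"
    using Gamma_real_pos[OF assms(1)] Gamma_real_plus1[OF assms(1)] by (simp_all add: add.commute)
  have f: "Gamma (real (r - s) + 1) = fact (r - s)"
    using Gamma_fact[of "r - s", where 'a = real] by (simp add: add.commute)
  have e: "real (r - s) + 1 + (real s + \<theta>) = real r + 1 + \<theta>" using assms by simp
  show ?thesis
    unfolding stick_coeff_def Beta_def f e using assms G
    by (simp add: binomial_fact Gamma_1 field_simps)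
qed

lemma stick_coeff_diag:
  assumes "\<theta> > 0" shows "stick_coeff \<theta> r r = \<theta> / (real r + \<theta>)"
proof -
  have "Gamma (real r + 1 + \<theta>) = (real r + \<theta>) * Gamma (real r + \<theta>)"
    using Gamma_real_plus1[of "real r + \<theta>"] assms by (simp add: add_ac)
  moreover have "Gamma (real r + \<theta>) > 0" using assms by (intro Gamma_real_pos) auto
  ultimately show ?thesis by (simp add: stick_coeff_def)
qed

text \<open>The ratio of consecutive coefficients in \<open>r\<close> does not depend on
  \<open>s\<close>. This lets all terms \<open>s < r\<close> of the moment formula collapse into the
  formula for \<open>r - 1\<close>.\<close>

lemma stick_coeff_Suc:
  assumes "\<theta> > 0"
  shows "(real (Suc r) + \<theta>) * stick_coeff \<theta> (Suc r) s = real (Suc r) * stick_coeff \<theta> r s"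
proof -
  have "Gamma (real (Suc r) + 1 + \<theta>) = (real (Suc r) + \<theta>) * Gamma (real r + 1 + \<theta>)"
    using Gamma_real_plus1[of "real (Suc r) + \<theta>"] assms by (simp add: add_ac)
  moreover have "real (Suc r) + \<theta> > 0" using assms by simp
  ultimately show ?thesis by (simp add: stick_coeff_def del: of_nat_Suc)
qed

text \<open>Stick breaking from fraction \<open>k\<close> on, the unbroken remainder being given
  value 0. The recursion isolates \<open>x k\<close> from the later fractions, which are independent
  of it.\<close>

fun stick_sum :: "(nat \<Rightarrow> real) \<Rightarrow> nat \<Rightarrow> real list \<Rightarrow> real" where
  "stick_sum x k [] = 0"
| "stick_sum x k (y # ys) = x k * y + (1 - x k) * stick_sum x (Suc k) ys"

text \<open>The moment of \<open>stick_sum\<close> for deterministic values, by binomial expansion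
  at the first stick. It does not involve \<open>k\<close>, since all fractions have the same law;
  \<open>0 ^ r\<close> is 1 exactly for \<open>r = 0\<close>.\<close>

fun stick_moment :: "real \<Rightarrow> nat \<Rightarrow> real list \<Rightarrow> real" where
  "stick_moment \<theta> r [] = 0 ^ r"
| "stick_moment \<theta> r (y # ys) = (\<Sum>s\<le>r. stick_coeff \<theta> r s * y ^ (r - s) * stick_moment \<theta> s ys)"

lemma stick_sum_restrict: "j \<le> k \<Longrightarrow> stick_sum (restrict x {j..}) k ys = stick_sum x k ys"
  by (induction ys arbitrary: k) auto

lemma stick_sum_map_upt:
  "stick_sum x k (map y [k..<k + R]) = (\<Sum>j<R. x (k + j) * (\<Prod>i\<in>{k..<k + j}. 1 - x i) * y (k + j))"
proof (induction R arbitrary: k)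
  case (Suc R)
  have "stick_sum x k (map y [k..<k + Suc R]) = x k * y k + (1 - x k) * stick_sum x (Suc k) (map y [Suc k..<Suc k + R])"
    by (simp add: upt_conv_Cons del: upt_Suc)
  also have "(1 - x k) * stick_sum x (Suc k) (map y [Suc k..<Suc k + R])
    = (\<Sum>j<R. x (Suc k + j) * ((1 - x k) * (\<Prod>i\<in>{Suc k..<Suc k + j}. 1 - x i)) * y (Suc k + j))"
    unfolding Suc.IH sum_distrib_left by (intro sum.cong) (auto simp: mult_ac)
  also have "\<dots> = (\<Sum>j<R. x (k + Suc j) * (\<Prod>i\<in>{k..<k + Suc j}. 1 - x i) * y (k + Suc j))"
    by (intro sum.cong refl, subst (2) prod.atLeast_Suc_lessThan) auto
  finally show ?case unfolding sum.lessThan_Suc_shift by simp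
qed simp

lemma stick_sum_abs_le:
  assumes "\<And>j. j \<ge> k \<Longrightarrow> 0 \<le> x j \<and> x j \<le> 1" "\<And>y. y \<in> set ys \<Longrightarrow> \<bar>y\<bar> \<le> 1"
  shows "\<bar>stick_sum x k ys\<bar> \<le> 1"
  using assms
proof (induction ys arbitrary: k)
  case (Cons y ys)
  have x: "0 \<le> x k" "x k \<le> 1" using Cons.prems(1)[of k] by auto
  have IH: "\<bar>stick_sum x (Suc k) ys\<bar> \<le> 1" using Cons.prems by (intro Cons.IH) auto
  have "\<bar>stick_sum x k (y # ys)\<bar> \<le> x k * \<bar>y\<bar> + (1 - x k) * \<bar>stick_sum x (Suc k) ys\<bar>"
    using x by (simp add: order_trans[OF abs_triangle_ineq] abs_mult)
  also have "\<dots> \<le> x k * 1 + (1 - x k) * 1"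
    using x IH Cons.prems(2)[of y] by (intro add_mono mult_left_mono) auto
  finally show ?case by simp
qed simp

lemma measurable_stick_sum:
  assumes "\<And>j. j \<ge> k \<Longrightarrow> (\<lambda>\<omega>. x \<omega> j) \<in> borel_measurable M"
  shows "(\<lambda>\<omega>. stick_sum (x \<omega>) k ys) \<in> borel_measurable M"
  using assms
proof (induction ys arbitrary: k)
  case (Cons y ys)
  have [measurable]: "(\<lambda>\<omega>. x \<omega> k) \<in> borel_measurable M" using Cons.prems by simp
  have [measurable]: "(\<lambda>\<omega>. stick_sum (x \<omega>) (Suc k) ys) \<in> borel_measurable M"
    by (rule Cons.IH) (use Cons.prems in auto)
  show ?case by simp
qed simp

locale stick_breaking =
  fixes N :: "'b measure" and X :: "nat \<Rightarrow> 'b \<Rightarrow> real" and \<theta> :: real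
  assumes prob: "prob_space N" and \<theta>: "\<theta> > 0"
    and indep_X: "prob_space.indep_vars N (\<lambda>_. borel) X {1..}"
    and X_beta: "\<And>j. j \<ge> 1 \<Longrightarrow> distributed N lborel (X j) (beta_density 1 \<theta>)"
begin

interpretation N: prob_space N by (rule prob)

section \<open>Stick sums with fixed values\<close>

lemma measurable_X: "j \<ge> 1 \<Longrightarrow> X j \<in> borel_measurable N"
  using distributed_measurable[OF X_beta] by simp

lemma AE_X: "AE \<omega> in N. \<forall>j\<ge>1. 0 < X j \<omega> \<and> X j \<omega> < 1"
proof -
  have "AE \<omega> in N. j \<ge> 1 \<longrightarrow> 0 < X j \<omega> \<and> X j \<omega> < 1" for j
    using N.beta_distributed_AE[OF X_beta, of j] by (cases "j \<ge> 1") auto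
  then show ?thesis by (simp add: AE_all_countable)
qed

lemma measurable_stick_sum_X: "k \<ge> 1 \<Longrightarrow> (\<lambda>\<omega>. stick_sum (\<lambda>j. X j \<omega>) k ys) \<in> borel_measurable N"
  by (rule measurable_stick_sum) (use measurable_X in auto)

text \<open>One null set serves all \<open>k\<close> and \<open>ys\<close>, so the bound may later
  be applied to the random list of states.\<close>

lemma AE_stick_sum: "AE \<omega> in N. \<forall>k\<ge>1. \<forall>ys. (\<forall>y\<in>set ys. \<bar>y\<bar> \<le> 1) \<longrightarrow> \<bar>stick_sum (\<lambda>j. X j \<omega>) k ys\<bar> \<le> 1"
  using AE_X
proof eventually_elim
  case (elim \<omega>)
  show ?case
  proof (intro allI impI)
    fix k :: nat and ys :: "real list" assume *: "k \<ge> 1" "\<forall>y\<in>set ys. \<bar>y\<bar> \<le> 1"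
    show "\<bar>stick_sum (\<lambda>j. X j \<omega>) k ys\<bar> \<le> 1"
    proof (rule stick_sum_abs_le)
      fix j assume "k \<le> j"
      then have "1 \<le> j" using * by simp
      then show "0 \<le> X j \<omega> \<and> X j \<omega> \<le> 1" using elim by (simp add: less_imp_le)
    qed (use * in auto)
  qed
qed

lemma integrable_stick_sum_power:
  assumes "k \<ge> 1" "\<forall>y\<in>set ys. \<bar>y\<bar> \<le> 1"
  shows "integrable N (\<lambda>\<omega>. stick_sum (\<lambda>j. X j \<omega>) k ys ^ r)"
proof (rule N.integrable_const_bound[where B = 1])
  show "AE \<omega> in N. norm (stick_sum (\<lambda>j. X j \<omega>) k ys ^ r) \<le> 1"
    using AE_stick_sum by eventually_elim (use assms in \<open>auto simp: power_abs intro!: power_le_one\<close>)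
qed (use measurable_stick_sum_X[OF assms(1)] in measurable)

text \<open>\<open>X k\<close> and the sum over the later sticks are functions of disjoint blocks of
  independent variables, so each binomial term factorises into a Beta moment and a moment of the
  tail.\<close>

lemma expectation_stick_sum_power:
  assumes "k \<ge> 1" "\<forall>y\<in>set ys. \<bar>y\<bar> \<le> 1"
  shows "(\<integral>\<omega>. stick_sum (\<lambda>j. X j \<omega>) k ys ^ r \<partial>N) = stick_moment \<theta> r ys"
  using assms
proof (induction ys arbitrary: k r)
  case Nil
  then show ?case by (simp add: N.prob_space)
next
  case (Cons y ys)
  define W where "W \<omega> = stick_sum (\<lambda>j. X j \<omega>) (Suc k) ys" for \<omega>
  have k: "Suc k \<ge> 1" and ys: "\<forall>y\<in>set ys. \<bar>y\<bar> \<le> 1" using Cons.prems by auto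
  note [measurable] = measurable_X[OF Cons.prems(1)] measurable_stick_sum_X[OF k, of ys, folded W_def]
  have intW: "integrable N (\<lambda>\<omega>. W \<omega> ^ s)" for s
    unfolding W_def by (rule integrable_stick_sum_power[OF k ys])
  have intX: "integrable N (\<lambda>\<omega>. X k \<omega> ^ a * (1 - X k \<omega>) ^ b)" for a b
  proof (rule N.integrable_const_bound[where B = 1])
    show "AE \<omega> in N. norm (X k \<omega> ^ a * (1 - X k \<omega>) ^ b) \<le> 1"
      using AE_X
    proof eventually_elim
      case (elim \<omega>)
      then have "0 < X k \<omega>" "X k \<omega> < 1" using Cons.prems(1) by auto
      then show ?case by (auto simp: abs_mult power_abs intro!: mult_le_one power_le_one)
    qed
  qed measurable
  have "N.indep_var (Pi\<^sub>M {k} (\<lambda>_. borel)) (\<lambda>\<omega>. restrict (\<lambda>i. X i \<omega>) {k})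
     (Pi\<^sub>M {Suc k..} (\<lambda>_. borel)) (\<lambda>\<omega>. restrict (\<lambda>i. X i \<omega>) {Suc k..})"
    by (rule N.indep_var_restrict[OF indep_X]) (use Cons.prems(1) in auto)
  then have ind: "N.indep_var borel ((\<lambda>x. x k ^ a * (1 - x k) ^ b) \<circ> (\<lambda>\<omega>. restrict (\<lambda>i. X i \<omega>) {k}))
      borel ((\<lambda>x. stick_sum x (Suc k) ys ^ s) \<circ> (\<lambda>\<omega>. restrict (\<lambda>i. X i \<omega>) {Suc k..}))" for a b s
  proof (rule N.indep_var_compose)
    show "(\<lambda>x :: nat \<Rightarrow> real. x k ^ a * (1 - x k) ^ b) \<in> borel_measurable (Pi\<^sub>M {k} (\<lambda>_. borel))"
    proof -
      have "(\<lambda>x :: nat \<Rightarrow> real. x k) \<in> borel_measurable (Pi\<^sub>M {k} (\<lambda>_. borel))"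
        by (rule measurable_component_singleton) simp
      then show ?thesis
        by (intro borel_measurable_times borel_measurable_power borel_measurable_diff borel_measurable_const)
    qed
    have [measurable]: "(\<lambda>x. stick_sum x (Suc k) ys) \<in> borel_measurable (Pi\<^sub>M {Suc k..} (\<lambda>_. borel))"
      by (rule measurable_stick_sum) measurable
    show "(\<lambda>x. stick_sum x (Suc k) ys ^ s) \<in> borel_measurable (Pi\<^sub>M {Suc k..} (\<lambda>_. borel))" by measurable
  qed
  have ind': "N.indep_var borel (\<lambda>\<omega>. X k \<omega> ^ a * (1 - X k \<omega>) ^ b) borel (\<lambda>\<omega>. W \<omega> ^ s)" for a b s
    using ind[of a b s] by (simp add: comp_def stick_sum_restrict W_def)
  have prodE: "(\<integral>\<omega>. (X k \<omega> ^ a * (1 - X k \<omega>) ^ b) * W \<omega> ^ s \<partial>N)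
      = Beta (real a + 1) (real b + \<theta>) / Beta 1 \<theta> * stick_moment \<theta> s ys" for a b s
  proof -
    have "(\<integral>\<omega>. (X k \<omega> ^ a * (1 - X k \<omega>) ^ b) * W \<omega> ^ s \<partial>N)
      = (\<integral>\<omega>. X k \<omega> ^ a * (1 - X k \<omega>) ^ b \<partial>N) * (\<integral>\<omega>. W \<omega> ^ s \<partial>N)"
      by (rule N.indep_var_lebesgue_integral[OF ind' intX intW])
    then show ?thesis
      using beta_distributed_moment[OF X_beta[OF Cons.prems(1)] \<theta>] Cons.IH[OF k ys] by (simp add: W_def)
  qed
  have prodI: "integrable N (\<lambda>\<omega>. (X k \<omega> ^ a * (1 - X k \<omega>) ^ b) * W \<omega> ^ s)" for a b s
    by (rule N.indep_var_integrable[OF ind' intX intW])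
  have "(\<integral>\<omega>. stick_sum (\<lambda>j. X j \<omega>) k (y # ys) ^ r \<partial>N)
    = (\<integral>\<omega>. (\<Sum>s\<le>r. real (r choose s) * y ^ (r - s) * ((X k \<omega> ^ (r - s) * (1 - X k \<omega>) ^ s) * W \<omega> ^ s)) \<partial>N)"
  proof (intro Bochner_Integration.integral_cong refl)
    fix \<omega>
    have "stick_sum (\<lambda>j. X j \<omega>) k (y # ys) ^ r = ((1 - X k \<omega>) * W \<omega> + X k \<omega> * y) ^ r"
      by (simp add: W_def add.commute)
    also have "\<dots> = (\<Sum>s\<le>r. real (r choose s) * y ^ (r - s) * ((X k \<omega> ^ (r - s) * (1 - X k \<omega>) ^ s) * W \<omega> ^ s))"
      unfolding binomial_ring by (intro sum.cong) (auto simp: power_mult_distrib mult_ac)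
    finally show "stick_sum (\<lambda>j. X j \<omega>) k (y # ys) ^ r
      = (\<Sum>s\<le>r. real (r choose s) * y ^ (r - s) * ((X k \<omega> ^ (r - s) * (1 - X k \<omega>) ^ s) * W \<omega> ^ s))" .
  qed
  also have "\<dots> = (\<Sum>s\<le>r. real (r choose s) * y ^ (r - s) *
      (Beta (real (r - s) + 1) (real s + \<theta>) / Beta 1 \<theta> * stick_moment \<theta> s ys))"
    by (subst Bochner_Integration.integral_sum) (auto simp: prodI prodE intro!: integrable_mult_right)
  also have "\<dots> = stick_moment \<theta> r (y # ys)"
    unfolding stick_moment.simps
    by (intro sum.cong refl) (simp add: Beta_stick_coeff[OF \<theta>, symmetric] mult_ac)
  finally show ?case .
qed

text \<open>Read off from the probabilistic meaning: a stick sum of values in \<open>[-1, 1]\<close>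
  almost surely lies in \<open>[-1, 1]\<close>.\<close>

lemma stick_moment_abs_le:
  assumes "\<forall>y\<in>set ys. \<bar>y\<bar> \<le> 1"
  shows "\<bar>stick_moment \<theta> r ys\<bar> \<le> 1"
  unfolding expectation_stick_sum_power[of 1, OF order_refl assms, symmetric]
proof (rule N.abs_expectation_le_AE)
  show "AE \<omega> in N. \<bar>stick_sum (\<lambda>j. X j \<omega>) 1 ys ^ r\<bar> \<le> 1"
    using AE_stick_sum by eventually_elim (use assms in \<open>auto simp: power_abs intro!: power_le_one\<close>)
qed simp

end


text \<open>Turns independence, given as a product rule on events, into the product measure that
  Fubini needs.\<close>

lemma distr_Pair_eq_pair_measure:
  assumes M: "prob_space M" and X[measurable]: "X \<in> measurable M S" and Y[measurable]: "Y \<in> measurable M T"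
    and prod: "\<And>A B. A \<in> sets S \<Longrightarrow> B \<in> sets T \<Longrightarrow>
      measure M {\<omega>\<in>space M. X \<omega> \<in> A \<and> Y \<omega> \<in> B}
        = measure M {\<omega>\<in>space M. X \<omega> \<in> A} * measure M {\<omega>\<in>space M. Y \<omega> \<in> B}"
  shows "distr M S X \<Otimes>\<^sub>M distr M T Y = distr M (S \<Otimes>\<^sub>M T) (\<lambda>\<omega>. (X \<omega>, Y \<omega>))"
proof -
  interpret prob_space M by (rule M)
  interpret DX: prob_space "distr M S X" by (rule prob_space_distr) measurable
  interpret DY: prob_space "distr M T Y" by (rule prob_space_distr) measurable
  show ?thesis
  proof (rule pair_measure_eqI)
    fix A B assume "A \<in> sets (distr M S X)" "B \<in> sets (distr M T Y)"
    then have A[measurable]: "A \<in> sets S" and B[measurable]: "B \<in> sets T" by auto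
    have "emeasure (distr M S X) A = ennreal (prob {\<omega>\<in>space M. X \<omega> \<in> A})"
      by (subst emeasure_distr) (auto simp: emeasure_eq_measure intro!: arg_cong[where f = "measure M"])
    moreover have "emeasure (distr M T Y) B = ennreal (prob {\<omega>\<in>space M. Y \<omega> \<in> B})"
      by (subst emeasure_distr) (auto simp: emeasure_eq_measure intro!: arg_cong[where f = "measure M"])
    moreover have "emeasure (distr M (S \<Otimes>\<^sub>M T) (\<lambda>\<omega>. (X \<omega>, Y \<omega>))) (A \<times> B)
      = ennreal (prob {\<omega>\<in>space M. X \<omega> \<in> A \<and> Y \<omega> \<in> B})"
      by (subst emeasure_distr) (auto simp: emeasure_eq_measure intro!: arg_cong[where f = "measure M"])
    ultimately show "emeasure (distr M S X) A * emeasure (distr M T Y) B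
      = emeasure (distr M (S \<Otimes>\<^sub>M T) (\<lambda>\<omega>. (X \<omega>, Y \<omega>))) (A \<times> B)"
      by (simp add: prod[OF A B] ennreal_mult)
  qed (auto intro: DX.sigma_finite_measure_axioms DY.sigma_finite_measure_axioms cong: sets_pair_measure_cong)
qed

text \<open>\<open>q\<close> is the time reversal of \<open>Q\<close> under \<mu>. The
  \<open>reversal\<close> hypothesis leaves its rows at states with \<open>\<mu> i = 0\<close>
  free.\<close>

locale gem_chain = stick_breaking N X \<theta>
  for N :: "'b measure" and X :: "nat \<Rightarrow> 'b \<Rightarrow> real" and \<theta> :: real +
  fixes T' :: "nat \<Rightarrow> 'b \<Rightarrow> 'x::countable" and \<mu> :: "'x \<Rightarrow> real" and Q :: "'x \<Rightarrow> 'x \<Rightarrow> real"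
    and q :: "'x \<Rightarrow> 'x pmf"
  assumes chain: "markov_chain N T' \<mu> (\<lambda>_. Q)"
    and indep: "\<forall>A\<in>sets (Pi\<^sub>M {1..} (\<lambda>_. borel)). \<forall>B\<in>sets (Pi\<^sub>M {1..} (\<lambda>_. count_space UNIV)).
      measure N {\<omega>\<in>space N. restrict (\<lambda>j. X j \<omega>) {1..} \<in> A \<and> restrict (\<lambda>j. T' j \<omega>) {1..} \<in> B}
      = measure N {\<omega>\<in>space N. restrict (\<lambda>j. X j \<omega>) {1..} \<in> A}
        * measure N {\<omega>\<in>space N. restrict (\<lambda>j. T' j \<omega>) {1..} \<in> B}"
    and reversal: "\<And>i j. \<mu> i * pmf (q i) j = \<mu> j * Q j i"
begin

interpretation N: prob_space N by (rule prob)

section \<open>Random states on the sticks, and time reversal\<close>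

lemma measurable_T' [measurable]: "T' j \<in> measurable N (count_space UNIV)"
  using chain by (auto simp: markov_chain_def)

abbreviation states :: "nat \<Rightarrow> 'b \<Rightarrow> 'x list" where
  "states R \<omega> \<equiv> map (\<lambda>k. T' k \<omega>) [1..<Suc R]"

lemma measurable_states [measurable]: "states R \<in> measurable N (count_space UNIV)"
  by (rule measurable_path) measurable

text \<open>Fubini integrates out the sticks with the states frozen, leaving an expectation of the
  chain alone, to which reversal applies.\<close>

lemma expectation_stick_sum_states:
  fixes c :: "'x list \<Rightarrow> real"
  assumes h: "unit_bounded h" and c: "unit_bounded c"
  shows "(\<integral>\<omega>. stick_sum (\<lambda>j. X j \<omega>) 1 (map h (states R \<omega>)) ^ r * c (states R \<omega>) \<partial>N)
    = (\<integral>\<omega>. stick_moment \<theta> r (map h (states R \<omega>)) * c (states R \<omega>) \<partial>N)"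
proof -
  let ?S = "count_space (UNIV :: 'x list set)" and ?PX = "Pi\<^sub>M {1::nat..} (\<lambda>_. borel :: real measure)"
  let ?X = "\<lambda>\<omega>. restrict (\<lambda>j. X j \<omega>) {1..}"
  have mX[measurable]: "?X \<in> measurable N ?PX"
    by (rule measurable_restrict) (use measurable_X in auto)
  have mmap: "(\<lambda>t. map t js) \<in> measurable (Pi\<^sub>M {1..} (\<lambda>_. count_space UNIV)) ?S"
    if "set js \<subseteq> {1::nat..}" for js
    using that
  proof (induction js)
    case (Cons j js)
    have [measurable]: "(\<lambda>t. t j) \<in> measurable (Pi\<^sub>M {1::nat..} (\<lambda>_. count_space (UNIV :: 'x set))) (count_space UNIV)"
      by (rule measurable_component_singleton) (use Cons.prems in auto)
    have [measurable]: "(\<lambda>t. map t js) \<in> measurable (Pi\<^sub>M {1..} (\<lambda>_. count_space UNIV)) ?S"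
      using Cons by auto
    have "(\<lambda>t. (\<lambda>(x, xs). x # xs) (t j, map t js)) \<in> measurable (Pi\<^sub>M {1..} (\<lambda>_. count_space UNIV)) ?S"
      by (rule measurable_compose[of _ _ "count_space UNIV"]) measurable
    then show ?case by simp
  qed simp
  have law: "distr N ?S (states R) \<Otimes>\<^sub>M distr N ?PX ?X = distr N (?S \<Otimes>\<^sub>M ?PX) (\<lambda>\<omega>. (states R \<omega>, ?X \<omega>))"
  proof (rule distr_Pair_eq_pair_measure[OF prob measurable_states mX])
    fix C A assume C: "C \<in> sets ?S" and A: "A \<in> sets ?PX"
    define B where "B = (\<lambda>t. map t [1..<Suc R]) -` C \<inter> space (Pi\<^sub>M {1::nat..} (\<lambda>_. count_space (UNIV :: 'x set)))"
    have B: "B \<in> sets (Pi\<^sub>M {1..} (\<lambda>_. count_space UNIV))"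
      unfolding B_def by (rule measurable_sets[OF mmap C]) (auto simp del: upt_Suc)
    have *: "restrict (\<lambda>j. T' j \<omega>) {1..} \<in> B \<longleftrightarrow> states R \<omega> \<in> C" for \<omega>
    proof -
      have "map (restrict (\<lambda>j. T' j \<omega>) {1..}) [1..<Suc R] = states R \<omega>"
        by (rule map_cong) auto
      then have "restrict (\<lambda>j. T' j \<omega>) {1..} \<in> B \<longleftrightarrow> states R \<omega> \<in> C
          \<and> restrict (\<lambda>j. T' j \<omega>) {1..} \<in> space (Pi\<^sub>M {1::nat..} (\<lambda>_. count_space (UNIV :: 'x set)))"
        by (simp only: B_def vimage_eq Int_iff)
      then show ?thesis by (simp only: space_PiM) auto
    qed
    show "measure N {\<omega>\<in>space N. states R \<omega> \<in> C \<and> ?X \<omega> \<in> A}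
      = measure N {\<omega>\<in>space N. states R \<omega> \<in> C} * measure N {\<omega>\<in>space N. ?X \<omega> \<in> A}"
      using bspec[OF bspec[OF indep A] B] unfolding * by (simp only: conj_commute mult.commute)
  qed
  interpret DX: prob_space "distr N ?PX ?X" by (rule N.prob_space_distr) measurable
  interpret DZ: prob_space "distr N ?S (states R)" by (rule N.prob_space_distr) measurable
  interpret DZX: pair_prob_space "distr N ?S (states R)" "distr N ?PX ?X" ..
  define \<phi> where "\<phi> z x = stick_sum x 1 (map h z) ^ r * c z" for z x
  have [measurable]: "(\<lambda>x. stick_sum x 1 ys) \<in> borel_measurable ?PX" for ys
    by (rule measurable_stick_sum) (auto intro: measurable_component_singleton)
  have m\<phi>z: "(\<lambda>x. \<phi> z x) \<in> borel_measurable ?PX" for z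
    unfolding \<phi>_def by measurable
  \<comment> \<open>Lists of states are countably many, so measurability in \<open>x\<close> for
    each fixed \<open>z\<close> is enough.\<close>
  have m\<phi>: "(\<lambda>(z, x). \<phi> z x) \<in> borel_measurable (?S \<Otimes>\<^sub>M ?PX)"
    by (rule measurable_pair_measure_countable1) (simp_all only: prod.case m\<phi>z countableI_type)
  have mp: "(\<lambda>\<omega>. (states R \<omega>, ?X \<omega>)) \<in> measurable N (?S \<Otimes>\<^sub>M ?PX)"
    by (rule measurable_Pair[OF measurable_states mX])
  have sX: "stick_sum (?X \<omega>) 1 ys = stick_sum (\<lambda>j. X j \<omega>) 1 ys" for \<omega> ys
    by (rule stick_sum_restrict) simp
  have h1: "\<forall>y\<in>set (map h z). \<bar>y\<bar> \<le> 1" for z using unit_boundedD[OF h] by auto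
  have int: "integrable N (\<lambda>\<omega>. \<phi> (states R \<omega>) (?X \<omega>))"
  proof (rule N.integrable_const_bound[where B = 1])
    show "AE \<omega> in N. norm (\<phi> (states R \<omega>) (?X \<omega>)) \<le> 1"
      using AE_stick_sum
    proof eventually_elim
      case (elim \<omega>)
      then have "\<bar>stick_sum (\<lambda>j. X j \<omega>) 1 (map h (states R \<omega>))\<bar> \<le> 1" using h1 by blast
      then show ?case unfolding \<phi>_def sX real_norm_def abs_mult power_abs
        by (intro mult_le_one power_le_one unit_boundedD[OF c]) auto
    qed
    show "(\<lambda>\<omega>. \<phi> (states R \<omega>) (?X \<omega>)) \<in> borel_measurable N"
      using measurable_compose[OF mp m\<phi>] by (simp only: prod.case)
  qed
  have "(\<integral>\<omega>. \<phi> (states R \<omega>) (?X \<omega>) \<partial>N)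
    = (\<integral>p. (\<lambda>(z, x). \<phi> z x) p \<partial>(distr N ?S (states R) \<Otimes>\<^sub>M distr N ?PX ?X))"
    unfolding law by (subst integral_distr[OF mp m\<phi>]) (simp only: prod.case)
  also have "\<dots> = (\<integral>z. (\<integral>x. \<phi> z x \<partial>distr N ?PX ?X) \<partial>distr N ?S (states R))"
  proof (rule DZX.integral_fst[symmetric])
    show "integrable (distr N ?S (states R) \<Otimes>\<^sub>M distr N ?PX ?X) (case_prod \<phi>)"
      unfolding law integrable_distr_eq[OF mp m\<phi>] using int by (simp only: prod.case)
  qed
  also have "\<dots> = (\<integral>z. stick_moment \<theta> r (map h z) * c z \<partial>distr N ?S (states R))"
  proof (intro Bochner_Integration.integral_cong refl)
    fix z
    have "(\<integral>x. \<phi> z x \<partial>distr N ?PX ?X) = (\<integral>\<omega>. \<phi> z (?X \<omega>) \<partial>N)"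
      by (rule integral_distr[OF mX m\<phi>z])
    also have "\<dots> = (\<integral>\<omega>. stick_sum (\<lambda>j. X j \<omega>) 1 (map h z) ^ r \<partial>N) * c z"
      unfolding \<phi>_def sX by simp
    also have "\<dots> = stick_moment \<theta> r (map h z) * c z"
      using expectation_stick_sum_power[of 1, OF order_refl h1] by simp
    finally show "(\<integral>x. \<phi> z x \<partial>distr N ?PX ?X) = stick_moment \<theta> r (map h z) * c z" .
  qed
  also have "\<dots> = (\<integral>\<omega>. stick_moment \<theta> r (map h (states R \<omega>)) * c (states R \<omega>) \<partial>N)"
    by (rule integral_distr[OF measurable_states]) simp
  finally show ?thesis unfolding \<phi>_def sX .
qed

text \<open>\<open>L r g\<close> restricted to the first \<open>R\<close> sticks, as only finite
  paths can be reversed.\<close>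

definition trunc_moment :: "('x \<Rightarrow> real) \<Rightarrow> nat \<Rightarrow> nat \<Rightarrow> ('x \<Rightarrow> real) \<Rightarrow> real" where
  "trunc_moment h R r g = (\<integral>\<omega>. stick_sum (\<lambda>j. X j \<omega>) 1 (map h (states R \<omega>)) ^ r * g (T' 1 \<omega>) \<partial>N)"

lemma trunc_moment_eq:
  assumes h: "unit_bounded h" and g: "unit_bounded g" and R: "R \<ge> 1"
  shows "trunc_moment h R r g = (\<integral>\<omega>. stick_moment \<theta> r (map h (states R \<omega>)) * g (T' 1 \<omega>) \<partial>N)"
proof -
  have "hd (states R \<omega>) = T' 1 \<omega>" for \<omega>
    using R by (simp add: hd_map del: upt_Suc)
  moreover have "unit_bounded (\<lambda>z. g (hd z))" using g by (simp add: unit_bounded_def)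
  ultimately show ?thesis
    using expectation_stick_sum_states[OF h, of "\<lambda>z. g (hd z)" R r] unfolding trunc_moment_def by simp
qed

text \<open>After the first stick is split off, the value \<open>h (T' 1)\<close> joins the test
  function and \<open>R\<close> sticks remain on \<open>T' 2, ..., T' (R + 1)\<close>. Reversal
  restarts these states at time 1 and replaces the dependence on the old first state by an
  application of \<open>q\<close>.\<close>

lemma trunc_moment_Suc:
  assumes h: "unit_bounded h" and g: "unit_bounded g" and R: "R \<ge> 1"
  shows "trunc_moment h (Suc R) r g
    = (\<Sum>s\<le>r. stick_coeff \<theta> r s * trunc_moment h R s (kernel_app q (\<lambda>x. h x ^ (r - s) * g x)))"
proof -
  let ?rest = "\<lambda>\<omega>. map (\<lambda>k. T' (Suc k) \<omega>) [1..<Suc R]"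
  define gs where "gs s x = h x ^ (r - s) * g x" for s x
  have gs: "unit_bounded (gs s)" for s
    unfolding gs_def by (intro unit_bounded_mult unit_bounded_power h g)
  have sm: "\<bar>stick_moment \<theta> s (map h z)\<bar> \<le> 1" for s z
    by (rule stick_moment_abs_le) (use unit_boundedD[OF h] in auto)
  have bd: "\<bar>stick_moment \<theta> s (map h z) * gs s y\<bar> \<le> 1" for s z y
    unfolding abs_mult by (intro mult_le_one sm unit_boundedD[OF gs]) auto
  have mrest[measurable]: "?rest \<in> measurable N (count_space UNIV)"
    by (rule measurable_path) measurable
  have int: "integrable N (\<lambda>\<omega>. stick_moment \<theta> s (map h (?rest \<omega>)) * gs s (T' 1 \<omega>))" for s
  proof (rule N.integrable_const_bound[where B = 1])
    show "AE \<omega> in N. norm (stick_moment \<theta> s (map h (?rest \<omega>)) * gs s (T' 1 \<omega>)) \<le> 1"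
      unfolding real_norm_def by (rule AE_I2) (rule bd)
  qed measurable
  have split: "states (Suc R) \<omega> = T' 1 \<omega> # ?rest \<omega>" for \<omega>
    by (simp add: upt_conv_Cons map_Suc_upt[symmetric] comp_def del: upt_Suc)
  have "trunc_moment h (Suc R) r g = (\<integral>\<omega>. stick_moment \<theta> r (map h (states (Suc R) \<omega>)) * g (T' 1 \<omega>) \<partial>N)"
    by (rule trunc_moment_eq[OF h g]) simp
  also have "\<dots> = (\<integral>\<omega>. (\<Sum>s\<le>r. stick_coeff \<theta> r s * (stick_moment \<theta> s (map h (?rest \<omega>)) * gs s (T' 1 \<omega>))) \<partial>N)"
    unfolding split list.map stick_moment.simps gs_def sum_distrib_right
    by (intro Bochner_Integration.integral_cong sum.cong refl) (simp add: mult_ac)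
  also have "\<dots> = (\<Sum>s\<le>r. stick_coeff \<theta> r s * (\<integral>\<omega>. stick_moment \<theta> s (map h (?rest \<omega>)) * gs s (T' 1 \<omega>) \<partial>N))"
    by (subst Bochner_Integration.integral_sum)
      (rule integrable_mult_right[OF int], simp only: integral_mult_right_zero)
  also have "\<dots> = (\<Sum>s\<le>r. stick_coeff \<theta> r s * trunc_moment h R s (kernel_app q (gs s)))"
  proof (intro sum.cong refl arg_cong2[where f = "(*)"])
    fix s
    have "(\<integral>\<omega>. stick_moment \<theta> s (map h (?rest \<omega>)) * gs s (T' 1 \<omega>) \<partial>N)
      = (\<integral>\<omega>. measure_pmf.expectation (q (T' 1 \<omega>)) (\<lambda>y. stick_moment \<theta> s (map h (states R \<omega>)) * gs s y) \<partial>N)"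
      by (rule stationary_reversal_expectation[where F = "\<lambda>z y. stick_moment \<theta> s (map h z) * gs s y",
          OF prob chain R reversal bd])
    also have "\<dots> = trunc_moment h R s (kernel_app q (gs s))"
      unfolding trunc_moment_eq[OF h unit_bounded_kernel_app[OF gs] R] by (simp add: kernel_app_def)
    finally show "(\<integral>\<omega>. stick_moment \<theta> s (map h (?rest \<omega>)) * gs s (T' 1 \<omega>) \<partial>N)
      = trunc_moment h R s (kernel_app q (gs s))" .
  qed
  finally show ?thesis unfolding gs_def .
qed

definition occupation :: "('x \<Rightarrow> real) \<Rightarrow> 'b \<Rightarrow> real" where
  "occupation h \<omega> = (\<Sum>j. gem_weight (\<lambda>i. X i \<omega>) (Suc j) * h (T' (Suc j) \<omega>))"

section \<open>The infinite stick sum and its moments\<close>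

lemma measurable_gem_weight: "j \<ge> 1 \<Longrightarrow> (\<lambda>\<omega>. gem_weight (\<lambda>i. X i \<omega>) j) \<in> borel_measurable N"
  unfolding gem_weight_def
  by (intro borel_measurable_times borel_measurable_prod borel_measurable_diff measurable_X) auto

lemma measurable_occupation [measurable]: "occupation h \<in> borel_measurable N"
proof -
  have [measurable]: "(\<lambda>\<omega>. gem_weight (\<lambda>i. X i \<omega>) (Suc j)) \<in> borel_measurable N" for j
    by (rule measurable_gem_weight) simp
  show ?thesis unfolding occupation_def by measurable
qed

lemma stick_sum_states:
  "stick_sum (\<lambda>j. X j \<omega>) 1 (map h (states R \<omega>)) = (\<Sum>j<R. gem_weight (\<lambda>i. X i \<omega>) (Suc j) * h (T' (Suc j) \<omega>))"
  using stick_sum_map_upt[of "\<lambda>j. X j \<omega>" 1 "\<lambda>k. h (T' k \<omega>)" R]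
  by (simp add: gem_weight_def comp_def del: upt_Suc)

text \<open>The mass bound is the bound on stick sums in which every value is 1.\<close>

lemma AE_gem_weight:
  "AE \<omega> in N. (\<forall>j\<ge>1. gem_weight (\<lambda>i. X i \<omega>) j \<ge> 0) \<and> summable (\<lambda>j. gem_weight (\<lambda>i. X i \<omega>) (Suc j))
     \<and> (\<Sum>j. gem_weight (\<lambda>i. X i \<omega>) (Suc j)) \<le> 1"
  using AE_X AE_stick_sum
proof eventually_elim
  case (elim \<omega>)
  have nn: "gem_weight (\<lambda>i. X i \<omega>) j \<ge> 0" if "j \<ge> 1" for j
    unfolding gem_weight_def using elim(1) that
    by (intro mult_nonneg_nonneg prod_nonneg) (auto simp: less_imp_le)
  have le: "(\<Sum>j<R. gem_weight (\<lambda>i. X i \<omega>) (Suc j)) \<le> 1" for R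
  proof -
    have "\<bar>stick_sum (\<lambda>j. X j \<omega>) 1 (map (\<lambda>_. 1) (states R \<omega>))\<bar> \<le> 1"
      using elim(2) by auto
    then show ?thesis using stick_sum_states[of \<omega> "\<lambda>_. 1" R] by simp
  qed
  have "summable (\<lambda>j. gem_weight (\<lambda>i. X i \<omega>) (Suc j))"
    by (rule summableI_nonneg_bounded[where x = 1]) (use nn le in auto)
  moreover from this have "(\<Sum>j. gem_weight (\<lambda>i. X i \<omega>) (Suc j)) \<le> 1"
    by (rule suminf_le_const) (use le in auto)
  ultimately show ?case using nn by auto
qed

lemma AE_stick_sum_tendsto:
  assumes h: "unit_bounded h"
  shows "AE \<omega> in N. (\<lambda>R. stick_sum (\<lambda>j. X j \<omega>) 1 (map h (states R \<omega>))) \<longlonglongrightarrow> occupation h \<omega>"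
  using AE_gem_weight
proof eventually_elim
  case (elim \<omega>)
  have "summable (\<lambda>j. gem_weight (\<lambda>i. X i \<omega>) (Suc j) * h (T' (Suc j) \<omega>))"
  proof (rule summable_comparison_test'[of "\<lambda>j. gem_weight (\<lambda>i. X i \<omega>) (Suc j)" 0])
    fix j
    show "norm (gem_weight (\<lambda>i. X i \<omega>) (Suc j) * h (T' (Suc j) \<omega>)) \<le> gem_weight (\<lambda>i. X i \<omega>) (Suc j)"
      using elim unit_boundedD[OF h] by (auto simp: abs_mult intro!: mult_left_le)
  qed (use elim in auto)
  then show ?case
    unfolding stick_sum_states occupation_def by (rule summable_LIMSEQ)
qed

lemma AE_occupation_le:
  assumes h: "unit_bounded h"
  shows "AE \<omega> in N. \<bar>occupation h \<omega>\<bar> \<le> 1"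
  using AE_stick_sum_tendsto[OF h] AE_stick_sum
proof eventually_elim
  case (elim \<omega>)
  have "\<bar>stick_sum (\<lambda>j. X j \<omega>) 1 (map h (states R \<omega>))\<bar> \<le> 1" for R
    using elim(2) unit_boundedD[OF h] by auto
  then show ?case by (intro LIMSEQ_le_const2[OF tendsto_rabs[OF elim(1)]]) auto
qed

definition occ_moment :: "('x \<Rightarrow> real) \<Rightarrow> nat \<Rightarrow> ('x \<Rightarrow> real) \<Rightarrow> real" where
  "occ_moment h r g = (\<integral>\<omega>. occupation h \<omega> ^ r * g (T' 1 \<omega>) \<partial>N)"

lemma AE_occ_moment_le:
  assumes h: "unit_bounded h" and g: "unit_bounded g"
  shows "AE \<omega> in N. \<bar>occupation h \<omega> ^ r * g (T' 1 \<omega>)\<bar> \<le> 1"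
  using AE_occupation_le[OF h]
  by eventually_elim
    (use unit_boundedD[OF g] in \<open>auto simp: abs_mult power_abs intro!: mult_le_one power_le_one\<close>)

lemma integrable_occ_moment:
  assumes h: "unit_bounded h" and g: "unit_bounded g"
  shows "integrable N (\<lambda>\<omega>. occupation h \<omega> ^ r * g (T' 1 \<omega>))"
  by (rule N.integrable_const_bound[where B = 1]) (use AE_occ_moment_le[OF h g] in auto)

lemma occ_moment_abs_le:
  assumes h: "unit_bounded h" and g: "unit_bounded g"
  shows "\<bar>occ_moment h r g\<bar> \<le> 1"
  unfolding occ_moment_def by (rule N.abs_expectation_le_AE[OF AE_occ_moment_le[OF h g]]) simp

lemma occ_moment_affine:
  assumes h: "unit_bounded h" and f: "unit_bounded f" and g: "unit_bounded g"
  shows "occ_moment h r (\<lambda>x. f x + c * (g x - f x)) = occ_moment h r f + c * (occ_moment h r g - occ_moment h r f)"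
proof -
  note i = integrable_occ_moment[OF h f, of r] integrable_occ_moment[OF h g, of r]
  have "occ_moment h r (\<lambda>x. f x + c * (g x - f x))
    = (\<integral>\<omega>. occupation h \<omega> ^ r * f (T' 1 \<omega>)
        + c * (occupation h \<omega> ^ r * g (T' 1 \<omega>) - occupation h \<omega> ^ r * f (T' 1 \<omega>)) \<partial>N)"
    unfolding occ_moment_def by (intro Bochner_Integration.integral_cong) (auto simp: algebra_simps)
  also have "\<dots> = occ_moment h r f + c * (occ_moment h r g - occ_moment h r f)"
    unfolding occ_moment_def using i by simp
  finally show ?thesis .
qed

lemma trunc_moment_tendsto:
  assumes h: "unit_bounded h" and g: "unit_bounded g"
  shows "(\<lambda>R. trunc_moment h R r g) \<longlonglongrightarrow> occ_moment h r g"
  unfolding trunc_moment_def occ_moment_def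
proof (rule integral_dominated_convergence[where w = "\<lambda>_. 1"])
  show "AE \<omega> in N. (\<lambda>R. stick_sum (\<lambda>j. X j \<omega>) 1 (map h (states R \<omega>)) ^ r * g (T' 1 \<omega>))
      \<longlonglongrightarrow> occupation h \<omega> ^ r * g (T' 1 \<omega>)"
    using AE_stick_sum_tendsto[OF h] by eventually_elim (intro tendsto_intros)
  show "AE \<omega> in N. norm (stick_sum (\<lambda>j. X j \<omega>) 1 (map h (states R \<omega>)) ^ r * g (T' 1 \<omega>)) \<le> 1" for R
    using AE_stick_sum
  proof eventually_elim
    case (elim \<omega>)
    have "\<bar>stick_sum (\<lambda>j. X j \<omega>) 1 (map h (states R \<omega>))\<bar> \<le> 1"
      using elim unit_boundedD[OF h] by auto
    then show ?case unfolding real_norm_def abs_mult power_abs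
      by (intro mult_le_one power_le_one unit_boundedD[OF g]) auto
  qed
  show "(\<lambda>\<omega>. stick_sum (\<lambda>j. X j \<omega>) 1 (map h (states R \<omega>)) ^ r * g (T' 1 \<omega>)) \<in> borel_measurable N" for R
  proof -
    have [measurable]: "(\<lambda>\<omega>. gem_weight (\<lambda>i. X i \<omega>) (Suc j)) \<in> borel_measurable N" for j
      by (rule measurable_gem_weight) simp
    show ?thesis unfolding stick_sum_states by measurable
  qed
qed auto

text \<open>As \<open>R\<close> tends to infinity the loss of one stick disappears, and the relation
  between \<open>R + 1\<close> and \<open>R\<close> becomes a fixed-point equation.\<close>

lemma occ_moment_stick:
  assumes h: "unit_bounded h" and g: "unit_bounded g"
  shows "occ_moment h r g = (\<Sum>s\<le>r. stick_coeff \<theta> r s * occ_moment h s (kernel_app q (\<lambda>x. h x ^ (r - s) * g x)))"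
proof (rule LIMSEQ_unique)
  show "(\<lambda>R. trunc_moment h (Suc R) r g) \<longlonglongrightarrow> occ_moment h r g"
    by (rule LIMSEQ_Suc[OF trunc_moment_tendsto[OF h g]])
  have "(\<lambda>R. \<Sum>s\<le>r. stick_coeff \<theta> r s * trunc_moment h R s (kernel_app q (\<lambda>x. h x ^ (r - s) * g x)))
    \<longlonglongrightarrow> (\<Sum>s\<le>r. stick_coeff \<theta> r s * occ_moment h s (kernel_app q (\<lambda>x. h x ^ (r - s) * g x)))"
    by (intro tendsto_sum tendsto_mult tendsto_const trunc_moment_tendsto h unit_bounded_kernel_app
        unit_bounded_mult unit_bounded_power g)
  then show "(\<lambda>R. trunc_moment h (Suc R) r g)
    \<longlonglongrightarrow> (\<Sum>s\<le>r. stick_coeff \<theta> r s * occ_moment h s (kernel_app q (\<lambda>x. h x ^ (r - s) * g x)))"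
    by (rule Lim_transform_eventually)
      (use trunc_moment_Suc[OF h g] in \<open>auto intro!: eventually_sequentiallyI[of 1]\<close>)
qed

text \<open>Multiply the fixed-point equation by \<open>r + \<theta>\<close>. The term
  \<open>s = r\<close> becomes \<open>\<theta> * L r (q g)\<close>. In the others
  \<open>h^(r-s) g = h^(r-1-s) (h g)\<close>, so with the coefficient recursion they form
  \<open>r\<close> times the same equation for \<open>r - 1\<close> and the test function
  \<open>h g\<close>.\<close>

lemma occ_moment_rec:
  assumes h: "unit_bounded h" and g: "unit_bounded g" and r: "r \<ge> 1"
  shows "(real r + \<theta>) * occ_moment h r g
    = \<theta> * occ_moment h r (kernel_app q g) + real r * occ_moment h (r - 1) (\<lambda>x. h x * g x)"
proof -
  obtain t where t: "r = Suc t" using r by (cases r) auto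
  have hg: "unit_bounded (\<lambda>x. h x * g x)" by (rule unit_bounded_mult[OF h g])
  let ?G = "\<lambda>s. occ_moment h s (kernel_app q (\<lambda>x. h x ^ (r - s) * g x))"
  have "(real r + \<theta>) * occ_moment h r g
    = (\<Sum>s\<le>t. (real r + \<theta>) * stick_coeff \<theta> r s * ?G s) + (real r + \<theta>) * stick_coeff \<theta> r r * ?G r"
  proof -
    have "occ_moment h r g = (\<Sum>s\<le>t. stick_coeff \<theta> r s * ?G s) + stick_coeff \<theta> r r * ?G r"
      unfolding occ_moment_stick[OF h g, of r] by (simp only: t sum.atMost_Suc)
    then show ?thesis by (simp only: distrib_left sum_distrib_left mult.assoc)
  qed
  also have "(real r + \<theta>) * stick_coeff \<theta> r r = \<theta>"
    using \<theta> by (simp add: stick_coeff_diag[OF \<theta>] add_nonneg_eq_0_iff)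
  also have "(\<Sum>s\<le>t. (real r + \<theta>) * stick_coeff \<theta> r s * ?G s)
    = (\<Sum>s\<le>t. real r * (stick_coeff \<theta> t s * occ_moment h s (kernel_app q (\<lambda>x. h x ^ (t - s) * (h x * g x)))))"
  proof (intro sum.cong refl)
    fix s assume "s \<in> {..t}"
    then have "r - s = Suc (t - s)" by (simp add: t)
    then show "(real r + \<theta>) * stick_coeff \<theta> r s * ?G s
      = real r * (stick_coeff \<theta> t s * occ_moment h s (kernel_app q (\<lambda>x. h x ^ (t - s) * (h x * g x))))"
      using stick_coeff_Suc[OF \<theta>, of t s] by (simp add: t mult_ac)
  qed
  also have "\<dots> = real r * occ_moment h t (\<lambda>x. h x * g x)"
    unfolding occ_moment_stick[OF h hg, of t] by (simp add: sum_distrib_left)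
  finally show ?thesis by (simp add: t)
qed

lemma occ_moment_0:
  assumes u: "\<And>x. pmf u x = \<mu> x"
  shows "occ_moment h 0 g = measure_pmf.expectation u g"
proof -
  obtain p where p: "\<And>z. pmf p z = measure N {\<omega>\<in>space N. T' 1 \<omega> = z}"
    "\<And>F :: 'x \<Rightarrow> real. (\<integral>\<omega>. F (T' 1 \<omega>) \<partial>N) = measure_pmf.expectation p F"
    by (rule law_pmf[OF prob measurable_T'[of 1]]) (erule that)
  have "pmf p z = \<mu> z" for z
    using chain unfolding markov_chain_def p(1) by (auto dest!: spec[of _ "1::nat"] spec[of _ "\<lambda>_. z"])
  then have "p = u" by (intro pmf_eqI) (simp add: u)
  then show ?thesis using p(2)[of g] by (simp add: occ_moment_def)
qed

end

section \<open>Convergence in distribution from moments\<close>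

text \<open>Exponentials of linear forms multiply to exponentials of linear forms, so their span is
  already an algebra. The expectation of each generator involves a single real random variable,
  whereas monomials would require joint moments.\<close>

inductive_set exp_span :: "(('x \<Rightarrow> real) \<Rightarrow> real) set" where
  exp_span_exp: "finite F \<Longrightarrow> (\<lambda>x. exp (\<Sum>l\<in>F. h l * x l)) \<in> exp_span"
| exp_span_add: "f \<in> exp_span \<Longrightarrow> g \<in> exp_span \<Longrightarrow> (\<lambda>x. f x + g x) \<in> exp_span"
| exp_span_scale: "f \<in> exp_span \<Longrightarrow> (\<lambda>x. c * f x) \<in> exp_span"

lemma exp_span_mult_exp:
  assumes "finite F" "g \<in> exp_span"
  shows "(\<lambda>x. exp (\<Sum>l\<in>F. h l * x l) * g x) \<in> exp_span"
  using assms(2)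
proof (induction g)
  case (exp_span_exp F' h')
  \<comment> \<open>Each coefficient family is extended by 0 to the union of the supports, so that
    the two sums add termwise.\<close>
  define k where "k l = (if l \<in> F then h l else 0) + (if l \<in> F' then h' l else 0)" for l
  have "(\<lambda>x. exp (\<Sum>l\<in>F. h l * x l) * exp (\<Sum>l\<in>F'. h' l * x l)) = (\<lambda>x. exp (\<Sum>l\<in>F \<union> F'. k l * x l))"
  proof
    fix x
    have "(\<Sum>l\<in>F \<union> F'. k l * x l) = (\<Sum>l\<in>F \<union> F'. (if l \<in> F then h l * x l else 0)) + (\<Sum>l\<in>F \<union> F'. (if l \<in> F' then h' l * x l else 0))"
      unfolding sum.distrib[symmetric] by (intro sum.cong) (auto simp: k_def distrib_right)
    also have "\<dots> = (\<Sum>l\<in>F. h l * x l) + (\<Sum>l\<in>F'. h' l * x l)"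
      using assms(1) exp_span_exp by (simp add: sum.If_cases Int_absorb1 Int_absorb2 Un_Int_distrib)
    finally show "exp (\<Sum>l\<in>F. h l * x l) * exp (\<Sum>l\<in>F'. h' l * x l) = exp (\<Sum>l\<in>F \<union> F'. k l * x l)"
      by (simp add: exp_add)
  qed
  then show ?case using exp_span.exp_span_exp[of "F \<union> F'" k] assms(1) exp_span_exp by simp
next
  case (exp_span_add f g)
  then show ?case using exp_span.exp_span_add by (simp add: distrib_left)
next
  case (exp_span_scale f c)
  from exp_span.exp_span_scale[OF exp_span_scale.IH, of c] show ?case by (simp add: mult_ac)
qed

lemma exp_span_mult:
  assumes "f \<in> exp_span" "g \<in> exp_span"
  shows "(\<lambda>x. f x * g x) \<in> exp_span"
  using assms(1)
proof (induction f)
  case (exp_span_exp F h)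
  then show ?case using exp_span_mult_exp assms(2) by blast
next
  case (exp_span_add f1 f2)
  then show ?case using exp_span.exp_span_add by (simp add: distrib_right)
next
  case (exp_span_scale f c)
  from exp_span.exp_span_scale[OF exp_span_scale.IH, of c] show ?case by (simp add: mult_ac)
qed

lemma exp_span_const: "(\<lambda>_. c) \<in> exp_span"
  using exp_span_scale[OF exp_span_exp[of "{}"], of c] by simp

lemma continuous_on_exp_span: "f \<in> exp_span \<Longrightarrow> continuous_on S f"
proof (induction f rule: exp_span.induct)
  case (exp_span_exp F h)
  have "continuous_on S (\<lambda>x. x l)" for l
    by (rule continuous_on_product_then_coordinatewise[OF continuous_on_id])
  then show ?case by (intro continuous_intros)
qed (intro continuous_intros; simp)+

text \<open>Tychonoff's theorem for the coordinatewise topology.\<close>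

lemma compact_unit_cube: "compact (PiE UNIV (\<lambda>_. {0..1}) :: ('x \<Rightarrow> real) set)"
proof -
  have "compactin (product_topology (\<lambda>_::'x. euclidean) UNIV) (PiE UNIV (\<lambda>_. {0..1::real}))"
    by (simp add: compactin_PiE)
  then show ?thesis by (simp add: euclidean_product_topology)
qed

lemma exp_span_dense:
  fixes f :: "('x::countable \<Rightarrow> real) \<Rightarrow> real"
  assumes "continuous_on UNIV f" "e > 0"
  obtains g where "g \<in> exp_span" "\<And>x. (\<forall>l. 0 \<le> x l \<and> x l \<le> 1) \<Longrightarrow> \<bar>f x - g x\<bar> < e"
proof -
  interpret function_ring_on "exp_span :: (('x \<Rightarrow> real) \<Rightarrow> real) set" "PiE UNIV (\<lambda>_. {0..1})"
  proof
    fix x y :: "'x \<Rightarrow> real" assume "x \<noteq> y"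
    then obtain l where l: "x l \<noteq> y l" by auto
    show "\<exists>f\<in>exp_span. f x \<noteq> f y"
      using l by (intro bexI[OF _ exp_span_exp[of "{l}" "\<lambda>_. 1"]]) auto
  qed (auto intro: compact_unit_cube continuous_on_exp_span exp_span_add exp_span_mult exp_span_const)
  have "continuous_on (PiE UNIV (\<lambda>_. {0..1})) f" using assms(1) by (rule continuous_on_subset) simp
  from Stone_Weierstrass_basic[OF this assms(2)] obtain g
    where g: "g \<in> exp_span" "\<forall>x\<in>PiE UNIV (\<lambda>_. {0..1}). \<bar>f x - g x\<bar> < e" by blast
  show ?thesis
    by (rule that[OF g(1)]) (intro g(2)[rule_format] PiE_I, auto)
qed

text \<open>Elements of \<open>exp_span\<close> can be unbounded on the whole space, so the bound
  comes from compactness of the cube. Countably many coordinates make \<open>Y\<close> Borel for the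
  product topology.\<close>

lemma (in prob_space) integrable_on_unit_cube:
  fixes Y :: "'a \<Rightarrow> 'x::countable \<Rightarrow> real" and f :: "('x \<Rightarrow> real) \<Rightarrow> real"
  assumes Y: "\<And>l. (\<lambda>\<omega>. Y \<omega> l) \<in> borel_measurable M" and cube: "AE \<omega> in M. \<forall>l. 0 \<le> Y \<omega> l \<and> Y \<omega> l \<le> 1"
    and f: "continuous_on UNIV f"
  shows "integrable M (\<lambda>\<omega>. f (Y \<omega>))"
proof -
  have "continuous_on (PiE UNIV (\<lambda>_. {0..1})) f" using f by (rule continuous_on_subset) simp
  then have "compact (f ` (PiE UNIV (\<lambda>_. {0..1})))" by (rule compact_continuous_image[OF _ compact_unit_cube])
  then obtain B where B: "\<And>x. (\<forall>l. 0 \<le> x l \<and> x l \<le> 1) \<Longrightarrow> \<bar>f x\<bar> \<le> B"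
    using compact_imp_bounded[of "f ` (PiE UNIV (\<lambda>_. {0..1}))"] unfolding bounded_iff by force
  have [measurable]: "Y \<in> borel_measurable M" by (rule measurable_coordinatewise_then_product[OF Y])
  have [measurable]: "f \<in> borel_measurable borel" using f by (rule borel_measurable_continuous_onI)
  show ?thesis
  proof (rule integrable_const_bound)
    show "AE \<omega> in M. norm (f (Y \<omega>)) \<le> B" using cube by eventually_elim (simp add: B)
  qed measurable
qed

text \<open>Approximate \<open>f\<close> uniformly on the cube within \<open>e / 3\<close>, once for
  \<open>Y n\<close> and once for \<open>V\<close>. The hypothesis on \<open>V\<close> is almost
  sure because the stick fractions lie in \<open>(0, 1)\<close> only almost surely.\<close>

lemma conv_in_distr_exponentialsI:
  fixes Y :: "nat \<Rightarrow> 'a \<Rightarrow> 'x::countable \<Rightarrow> real" and V :: "'b \<Rightarrow> 'x \<Rightarrow> real"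
  assumes M: "prob_space M" and N: "prob_space N"
    and Y: "\<And>n l. (\<lambda>\<omega>. Y n \<omega> l) \<in> borel_measurable M" and V: "\<And>l. (\<lambda>\<omega>. V \<omega> l) \<in> borel_measurable N"
    and Y01: "\<And>n \<omega> l. 0 \<le> Y n \<omega> l \<and> Y n \<omega> l \<le> 1" and V01: "AE \<omega> in N. \<forall>l. 0 \<le> V \<omega> l \<and> V \<omega> l \<le> 1"
    and lim: "\<And>F h. finite F \<Longrightarrow> (\<lambda>n. \<integral>\<omega>. exp (\<Sum>l\<in>F. h l * Y n \<omega> l) \<partial>M)
        \<longlonglongrightarrow> (\<integral>\<omega>. exp (\<Sum>l\<in>F. h l * V \<omega> l) \<partial>N)"
  shows "conv_in_distr M Y N V"
proof -
  interpret M: prob_space M by (rule M)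
  interpret N: prob_space N by (rule N)
  have intM: "integrable M (\<lambda>\<omega>. f (Y n \<omega>))" if "continuous_on UNIV f" for f :: "('x \<Rightarrow> real) \<Rightarrow> real" and n
    by (rule M.integrable_on_unit_cube[OF Y _ that]) (use Y01 in simp)
  have intN: "integrable N (\<lambda>\<omega>. f (V \<omega>))" if "continuous_on UNIV f" for f :: "('x \<Rightarrow> real) \<Rightarrow> real"
    by (rule N.integrable_on_unit_cube[OF V V01 that])
  have span: "(\<lambda>n. \<integral>\<omega>. g (Y n \<omega>) \<partial>M) \<longlonglongrightarrow> (\<integral>\<omega>. g (V \<omega>) \<partial>N)" if "g \<in> exp_span" for g
    using that
  proof (induction g rule: exp_span.induct)
    case (exp_span_exp F h)
    then show ?case by (rule lim)
  next
    case (exp_span_add f g)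
    note c = exp_span_add.hyps[THEN continuous_on_exp_span]
    show ?case using tendsto_add[OF exp_span_add.IH] by (simp add: intM intN c)
  next
    case (exp_span_scale f c)
    show ?case using tendsto_mult_left[OF exp_span_scale.IH, of c] by simp
  qed
  show ?thesis
    unfolding conv_in_distr_def
  proof (intro allI impI)
    fix f :: "('x \<Rightarrow> real) \<Rightarrow> real" assume "continuous_on UNIV f \<and> bounded (range f)"
    then have f: "continuous_on UNIV f" by simp
    show "(\<lambda>n. \<integral>\<omega>. f (Y n \<omega>) \<partial>M) \<longlonglongrightarrow> (\<integral>\<omega>. f (V \<omega>) \<partial>N)"
    proof (rule LIMSEQ_I)
      fix e :: real assume e: "e > 0"
      then have "e / 3 > 0" by simp
      from exp_span_dense[OF f this] obtain g where g: "g \<in> exp_span"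
        "\<And>x. (\<forall>l. 0 \<le> x l \<and> x l \<le> 1) \<Longrightarrow> \<bar>f x - g x\<bar> < e / 3" by blast
      note gc = continuous_on_exp_span[OF g(1)]
      have 1: "\<bar>(\<integral>\<omega>. f (Y n \<omega>) \<partial>M) - (\<integral>\<omega>. g (Y n \<omega>) \<partial>M)\<bar> \<le> e / 3" for n
      proof -
        have "\<bar>\<integral>\<omega>. f (Y n \<omega>) - g (Y n \<omega>) \<partial>M\<bar> \<le> e / 3"
          by (rule M.abs_expectation_le_AE) (use g(2) Y01 e in \<open>auto intro!: AE_I2 less_imp_le\<close>)
        then show ?thesis by (simp add: intM f gc)
      qed
      have 2: "\<bar>(\<integral>\<omega>. f (V \<omega>) \<partial>N) - (\<integral>\<omega>. g (V \<omega>) \<partial>N)\<bar> \<le> e / 3"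
      proof -
        have "AE \<omega> in N. \<bar>f (V \<omega>) - g (V \<omega>)\<bar> \<le> e / 3"
          using V01 by eventually_elim (use g(2) in \<open>auto intro: less_imp_le\<close>)
        then have "\<bar>\<integral>\<omega>. f (V \<omega>) - g (V \<omega>) \<partial>N\<bar> \<le> e / 3"
          by (rule N.abs_expectation_le_AE) (use e in simp)
        then show ?thesis by (simp add: intN f gc)
      qed
      obtain n0 where n0: "\<And>n. n \<ge> n0 \<Longrightarrow> \<bar>(\<integral>\<omega>. g (Y n \<omega>) \<partial>M) - (\<integral>\<omega>. g (V \<omega>) \<partial>N)\<bar> < e / 3"
        using LIMSEQ_D[OF span[OF g(1)] \<open>e / 3 > 0\<close>] by auto
      have "norm ((\<integral>\<omega>. f (Y n \<omega>) \<partial>M) - (\<integral>\<omega>. f (V \<omega>) \<partial>N)) < e" if "n \<ge> n0" for n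
        using 1[of n] 2 n0[OF that] unfolding real_norm_def by linarith
      then show "\<exists>n0. \<forall>n\<ge>n0. norm ((\<integral>\<omega>. f (Y n \<omega>) \<partial>M) - (\<integral>\<omega>. f (V \<omega>) \<partial>N)) < e" by blast
    qed
  qed
qed

section \<open>From power moments to exponential moments\<close>

lemma (in prob_space) exp_moment_expansion:
  fixes Z :: "'a \<Rightarrow> real"
  assumes [measurable]: "Z \<in> borel_measurable M" and Z: "AE \<omega> in M. \<bar>Z \<omega>\<bar> \<le> 1"
  shows "expectation (\<lambda>\<omega>. exp (B * Z \<omega>)) = (\<Sum>r. B ^ r / fact r * expectation (\<lambda>\<omega>. Z \<omega> ^ r))"
proof -
  define f where "f r \<omega> = B ^ r / fact r * Z \<omega> ^ r" for r \<omega>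
  have f_le: "AE \<omega> in M. \<bar>f r \<omega>\<bar> \<le> \<bar>B\<bar> ^ r / fact r" for r
    using Z
  proof eventually_elim
    case (elim \<omega>)
    have "\<bar>f r \<omega>\<bar> = \<bar>B\<bar> ^ r / fact r * \<bar>Z \<omega>\<bar> ^ r" by (simp add: f_def abs_mult power_abs)
    also have "\<dots> \<le> \<bar>B\<bar> ^ r / fact r * 1" using elim by (intro mult_left_mono power_le_one) auto
    finally show ?case by simp
  qed
  have [measurable]: "f r \<in> borel_measurable M" for r unfolding f_def by measurable
  have int: "integrable M (f r)" for r
    by (rule integrable_const_bound) (use f_le in auto)
  have sumB: "summable (\<lambda>r. \<bar>B\<bar> ^ r / fact r)"
    using summable_exp[of "\<bar>B\<bar>"] by (simp add: field_simps)
  have sum_f: "summable (\<lambda>r. norm (f r \<omega>))" for \<omega>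
    using summable_norm_exp[of "B * Z \<omega>"] by (simp add: f_def power_mult_distrib abs_mult divide_inverse mult_ac)
  have exp: "exp (B * Z \<omega>) = (\<Sum>r. f r \<omega>)" for \<omega>
    by (simp add: exp_def f_def power_mult_distrib scaleR_conv_of_real divide_inverse mult_ac)
  have "expectation (\<lambda>\<omega>. exp (B * Z \<omega>)) = (\<Sum>r. expectation (f r))"
    unfolding exp
  proof (rule integral_suminf[OF int])
    show "summable (\<lambda>r. expectation (\<lambda>\<omega>. norm (f r \<omega>)))"
    proof (rule summable_comparison_test'[OF sumB])
      fix r
      have "AE \<omega> in M. \<bar>norm (f r \<omega>)\<bar> \<le> \<bar>B\<bar> ^ r / fact r" using f_le[of r] by simp
      from abs_expectation_le_AE[OF this]
      show "norm (expectation (\<lambda>\<omega>. norm (f r \<omega>))) \<le> \<bar>B\<bar> ^ r / fact r" by simp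
    qed
  qed (use sum_f in auto)
  also have "\<dots> = (\<Sum>r. B ^ r / fact r * expectation (\<lambda>\<omega>. Z \<omega> ^ r))" unfolding f_def by simp
  finally show ?thesis .
qed

text \<open>All moments are bounded by 1, so the series of moments is dominated by
  \<open>\<bar>B\<bar>^r / r!\<close> uniformly in \<open>n\<close>, and Tannery's theorem exchanges
  limit and sum.\<close>

lemma exp_expectation_tendsto:
  fixes Z :: "nat \<Rightarrow> 'a \<Rightarrow> real" and W :: "'b \<Rightarrow> real"
  assumes M: "prob_space M" and N: "prob_space N"
    and [measurable]: "\<And>n. Z n \<in> borel_measurable M" "W \<in> borel_measurable N"
    and Z: "\<And>n. AE \<omega> in M. \<bar>Z n \<omega>\<bar> \<le> 1" and W: "AE \<omega> in N. \<bar>W \<omega>\<bar> \<le> 1"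
    and lim: "\<And>r. (\<lambda>n. \<integral>\<omega>. Z n \<omega> ^ r \<partial>M) \<longlonglongrightarrow> (\<integral>\<omega>. W \<omega> ^ r \<partial>N)"
  shows "(\<lambda>n. \<integral>\<omega>. exp (B * Z n \<omega>) \<partial>M) \<longlonglongrightarrow> (\<integral>\<omega>. exp (B * W \<omega>) \<partial>N)"
proof -
  interpret M: prob_space M by (rule M)
  interpret N: prob_space N by (rule N)
  have sumB: "summable (\<lambda>r. \<bar>B\<bar> ^ r / fact r)"
    using summable_exp[of "\<bar>B\<bar>"] by (simp add: field_simps)
  have le1: "\<bar>\<integral>\<omega>. Z n \<omega> ^ r \<partial>M\<bar> \<le> 1" for n r
  proof (rule M.abs_expectation_le_AE)
    show "AE \<omega> in M. \<bar>Z n \<omega> ^ r\<bar> \<le> 1"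
      using Z[of n] by eventually_elim (auto simp: power_abs intro!: power_le_one)
  qed simp
  have "(\<lambda>n. \<Sum>r. B ^ r / fact r * (\<integral>\<omega>. Z n \<omega> ^ r \<partial>M)) \<longlonglongrightarrow> (\<Sum>r. B ^ r / fact r * (\<integral>\<omega>. W \<omega> ^ r \<partial>N))"
  proof (rule conjunct2[OF conjunct2[OF tannerys_theorem[OF _ _ sumB]]])
    show "(\<lambda>n. B ^ r / fact r * (\<integral>\<omega>. Z n \<omega> ^ r \<partial>M)) \<longlonglongrightarrow> B ^ r / fact r * (\<integral>\<omega>. W \<omega> ^ r \<partial>N)" for r
      by (intro tendsto_intros lim)
    have "norm (B ^ r / fact r * (\<integral>\<omega>. Z n \<omega> ^ r \<partial>M)) \<le> \<bar>B\<bar> ^ r / fact r" for r n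
    proof -
      have "\<bar>B ^ r / fact r * (\<integral>\<omega>. Z n \<omega> ^ r \<partial>M)\<bar> \<le> \<bar>B\<bar> ^ r / fact r * 1"
        unfolding abs_mult using le1[of n r] by (intro mult_mono) (auto simp: power_abs)
      then show ?thesis by simp
    qed
    then show "\<forall>\<^sub>F (r, n) in sequentially \<times>\<^sub>F sequentially.
        norm (B ^ r / fact r * (\<integral>\<omega>. Z n \<omega> ^ r \<partial>M)) \<le> \<bar>B\<bar> ^ r / fact r"
      by (intro always_eventually) auto
  qed simp
  then show ?thesis using M.exp_moment_expansion[OF _ Z] N.exp_moment_expansion[OF _ W] by simp
qed

text \<open>Unconditional summability of reals is absolute summability, and \<open>infsum\<close> is
  0 otherwise. The value is needed at every point, null sets included, for measurability.\<close>

lemma infsum_atLeast_1_eq_suminf: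
  fixes f :: "nat \<Rightarrow> real"
  shows "(\<Sum>\<^sub>\<infinity>j\<in>{1..}. f j) = (if summable (\<lambda>j. \<bar>f (Suc j)\<bar>) then \<Sum>j. f (Suc j) else 0)"
proof -
  have "{1..} = range Suc" by (auto simp: image_iff Suc_le_eq gr0_conv_Suc)
  then have "(\<Sum>\<^sub>\<infinity>j\<in>{1..}. f j) = (\<Sum>\<^sub>\<infinity>j. f (Suc j))" by (simp add: infsum_reindex comp_def)
  also have "\<dots> = (if summable (\<lambda>j. \<bar>f (Suc j)\<bar>) then \<Sum>j. f (Suc j) else 0)"
  proof (cases "summable (\<lambda>j. \<bar>f (Suc j)\<bar>)")
    case True
    then have "((\<lambda>j. f (Suc j)) has_sum (\<Sum>j. f (Suc j))) UNIV"
      by (intro norm_summable_imp_has_sum) (auto dest: summable_rabs_cancel)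
    then show ?thesis using True by (simp add: infsumI)
  next
    case False
    then have "\<not> (\<lambda>j. \<bar>f (Suc j)\<bar>) summable_on UNIV" by (simp add: summable_on_UNIV_nonneg_real_iff)
    then have "\<not> (\<lambda>j. f (Suc j)) summable_on UNIV"
      using summable_on_iff_abs_summable_on_real[of "\<lambda>j. f (Suc j)" UNIV] by auto
    then show ?thesis using False by (simp add: infsum_not_exists)
  qed
  finally show ?thesis .
qed

lemma borel_measurable_infsum_atLeast_1:
  fixes f :: "nat \<Rightarrow> 'a \<Rightarrow> real"
  assumes "\<And>j. j \<ge> 1 \<Longrightarrow> f j \<in> borel_measurable M"
  shows "(\<lambda>\<omega>. \<Sum>\<^sub>\<infinity>j\<in>{1..}. f j \<omega>) \<in> borel_measurable M"
proof -
  have [measurable]: "f (Suc j) \<in> borel_measurable M" for j using assms by simp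
  \<comment> \<open>The Cauchy criterion presents summability as a measurable event.\<close>
  have "summable (\<lambda>j. \<bar>f (Suc j) \<omega>\<bar>) \<longleftrightarrow> Cauchy (\<lambda>n. \<Sum>j<n. \<bar>f (Suc j) \<omega>\<bar>)" for \<omega>
    by (simp add: summable_iff_convergent Cauchy_convergent_iff)
  then have [measurable]: "Measurable.pred M (\<lambda>\<omega>. summable (\<lambda>j. \<bar>f (Suc j) \<omega>\<bar>))"
    unfolding pred_def by simp measurable
  show ?thesis unfolding infsum_atLeast_1_eq_suminf by measurable
qed

text \<open>The last claim reduces any finite set of coordinates of \<open>V\<close> to the integral
  of one finitely supported function, to which the moment recursion applies.\<close>

lemma (in gem_chain) occupation_measure:
  defines "V \<equiv> \<lambda>\<omega> l. \<Sum>\<^sub>\<infinity>j\<in>{1..}. gem_weight (\<lambda>i. X i \<omega>) j * (if T' j \<omega> = l then 1 else 0)"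
  shows "\<And>l. (\<lambda>\<omega>. V \<omega> l) \<in> borel_measurable N"
    and "AE \<omega> in N. \<forall>l. 0 \<le> V \<omega> l \<and> V \<omega> l \<le> 1"
    and "finite F \<Longrightarrow> AE \<omega> in N. (\<Sum>l\<in>F. h l * V \<omega> l) = occupation (\<lambda>x. if x \<in> F then h x else 0) \<omega>"
proof -
  show "(\<lambda>\<omega>. V \<omega> l) \<in> borel_measurable N" for l
    unfolding V_def
  proof (rule borel_measurable_infsum_atLeast_1)
    fix j :: nat assume "j \<ge> 1"
    note [measurable] = measurable_gem_weight[OF this]
    show "(\<lambda>\<omega>. gem_weight (\<lambda>i. X i \<omega>) j * (if T' j \<omega> = l then 1 else 0)) \<in> borel_measurable N"
      by measurable
  qed
  define w where "w j l \<omega> = gem_weight (\<lambda>i. X i \<omega>) (Suc j) * (if T' (Suc j) \<omega> = l then 1 else 0)" for j l \<omega>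
  have V: "AE \<omega> in N. \<forall>l. (\<lambda>j. w j l \<omega>) sums V \<omega> l \<and> 0 \<le> V \<omega> l \<and> V \<omega> l \<le> 1"
    using AE_gem_weight
  proof eventually_elim
    case (elim \<omega>)
    let ?p = "\<lambda>j. gem_weight (\<lambda>i. X i \<omega>) (Suc j)"
    have nn: "0 \<le> ?p j" for j using elim by simp
    show ?case
    proof
      fix l
      have le: "0 \<le> w j l \<omega> \<and> w j l \<omega> \<le> ?p j" for j using nn by (simp add: w_def)
      have s: "summable (\<lambda>j. \<bar>w j l \<omega>\<bar>)"
        by (rule summable_comparison_test'[of ?p 0]) (use elim le in auto)
      then have s': "summable (\<lambda>j. w j l \<omega>)" by (rule summable_rabs_cancel)
      have VV: "V \<omega> l = (\<Sum>j. w j l \<omega>)"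
        using s unfolding V_def infsum_atLeast_1_eq_suminf w_def by simp
      have "(\<Sum>j. w j l \<omega>) \<le> (\<Sum>j. ?p j)" by (rule suminf_le) (use le s' elim in auto)
      then show "(\<lambda>j. w j l \<omega>) sums V \<omega> l \<and> 0 \<le> V \<omega> l \<and> V \<omega> l \<le> 1"
        unfolding VV using s' le elim by (auto intro!: suminf_nonneg)
    qed
  qed
  then show "AE \<omega> in N. \<forall>l. 0 \<le> V \<omega> l \<and> V \<omega> l \<le> 1" by eventually_elim auto
  show "AE \<omega> in N. (\<Sum>l\<in>F. h l * V \<omega> l) = occupation (\<lambda>x. if x \<in> F then h x else 0) \<omega>" if F: "finite F"
    using V
  proof eventually_elim
    case (elim \<omega>)
    have "(\<lambda>j. \<Sum>l\<in>F. h l * w j l \<omega>) sums (\<Sum>l\<in>F. h l * V \<omega> l)"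
      by (intro sums_sum sums_mult) (use elim in auto)
    moreover have "(\<Sum>l\<in>F. h l * w j l \<omega>)
        = gem_weight (\<lambda>i. X i \<omega>) (Suc j) * (if T' (Suc j) \<omega> \<in> F then h (T' (Suc j) \<omega>) else 0)" for j
    proof -
      have "(\<Sum>l\<in>F. h l * w j l \<omega>)
        = (\<Sum>l\<in>F. if T' (Suc j) \<omega> = l then gem_weight (\<lambda>i. X i \<omega>) (Suc j) * h l else 0)"
        by (intro sum.cong) (auto simp: w_def)
      then show ?thesis using F by simp
    qed
    ultimately show ?case unfolding occupation_def by (simp add: sums_iff)
  qed
qed

section \<open>Powers of a kernel\<close>

primrec iterate_kernel :: "('x \<Rightarrow> 'x pmf) \<Rightarrow> nat \<Rightarrow> 'x \<Rightarrow> 'x pmf" where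
  "iterate_kernel q 0 i = return_pmf i"
| "iterate_kernel q (Suc k) i = bind_pmf (iterate_kernel q k i) q"

lemma mpow_eq_iterate_kernel:
  assumes "\<And>i j. pmf (q i) j = A i j"
  shows "mpow A k i j = pmf (iterate_kernel q k i) j"
proof (induction k arbitrary: j)
  case 0
  show ?case by (simp add: idm_def indicator_def)
next
  case (Suc k)
  have "pmf (iterate_kernel q (Suc k) i) j = (\<integral>x. pmf (iterate_kernel q k i) x * pmf (q x) j \<partial>count_space UNIV)"
    by (simp add: pmf_bind expectation_pmf_count_space)
  also have "\<dots> = (\<Sum>\<^sub>\<infinity>x. pmf (iterate_kernel q k i) x * pmf (q x) j)"
    by (rule infsumI[OF has_sum_of_integrable_count_space, symmetric])
      (rule integrable_pmf_count_space[where B = 1], simp add: pmf_le_1)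
  finally show ?case by (simp add: Suc assms)
qed

text \<open>Duality between kernels moving laws and acting on functions: the last jump of the law is
  the first operator applied to \<open>g\<close>.\<close>

lemma expectation_iterate_kernel:
  assumes "unit_bounded g"
  shows "measure_pmf.expectation (iterate_kernel q k i) g = (kernel_app q ^^ k) g i"
  using assms
proof (induction k arbitrary: g)
  case (Suc k)
  have "measure_pmf.expectation (iterate_kernel q (Suc k) i) g
    = measure_pmf.expectation (iterate_kernel q k i) (kernel_app q g)"
    using expectation_bind_pmf[of g 1 "iterate_kernel q k i" q] unit_boundedD[OF Suc.prems]
    by (simp add: kernel_app_def[abs_def])
  also have "\<dots> = (kernel_app q ^^ k) (kernel_app q g) i"
    by (rule Suc.IH[OF unit_bounded_kernel_app[OF Suc.prems]])
  finally show ?case by (simp add: funpow_swap1)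
qed simp

section \<open>The limit of the occupation measures\<close>

lemma idm_has_sum: "(idm i has_sum 1) UNIV"
  by (rule has_sum_finite_neutralI[of "{i}"]) (auto simp: idm_def)

text \<open>Stationarity writes \<open>\<mu> i = 0\<close> as a sum of nonnegative terms, so no mass
  flows into a null state.\<close>

lemma stationary_zero:
  assumes "stationary Q \<mu>" "stochastic Q" "\<mu> i = 0"
  shows "\<mu> j * Q j i = 0"
proof -
  have s: "((\<lambda>j. \<mu> j * Q j i) has_sum 0) UNIV"
    using assms unfolding stationary_def by (metis (no_types))
  have nn: "0 \<le> \<mu> j * Q j i" for j
    using assms by (simp add: stationary_def stochastic_def prob_vector_def)
  have "AE j in count_space UNIV. \<mu> j * Q j i = 0"
    using has_sum_count_space[OF s] nn by (subst integral_nonneg_eq_0_iff_AE[symmetric]) auto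
  then show ?thesis by (simp add: AE_count_space)
qed

text \<open>Stationarity of \<mu> is what makes the rows of the reversal sum to 1. At null states
  the indicator in \<open>G'\<close> leaves the identity row, and balance holds because no mass
  flows in.\<close>

lemma reversed_kernel:
  fixes Q :: "'x \<Rightarrow> 'x \<Rightarrow> real"
  assumes "stationary Q \<mu>" "stochastic Q"
  defines "R \<equiv> \<lambda>i j. if \<mu> i = 0 then idm i j else \<mu> j * Q j i / \<mu> i"
  shows "prob_vector (R i)" "\<mu> i * R i j = \<mu> j * Q j i"
proof -
  have nn: "0 \<le> \<mu> j" "0 \<le> Q j i" for i j
    using assms(1,2) by (simp_all add: stationary_def stochastic_def prob_vector_def)
  have s: "((\<lambda>j. \<mu> j * Q j i) has_sum \<mu> i) UNIV"
    using assms(1) by (simp add: stationary_def)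
  show "prob_vector (R i)"
  proof (cases "\<mu> i = 0")
    case True
    then have "R i = idm i" by (simp add: R_def)
    moreover have "0 \<le> idm i j" for j by (simp add: idm_def)
    ultimately show ?thesis using idm_has_sum[of i] by (simp add: prob_vector_def)
  next
    case False
    then have "((\<lambda>j. 1 / \<mu> i * (\<mu> j * Q j i)) has_sum 1 / \<mu> i * \<mu> i) UNIV"
      by (intro has_sum_cmult_right s)
    then show ?thesis using False nn by (simp add: prob_vector_def R_def)
  qed
  show "\<mu> i * R i j = \<mu> j * Q j i"
    using stationary_zero[OF assms(1,2), of i j] by (simp add: R_def)
qed

text \<open>The row sum is 1 for every real \<open>c\<close>; nonnegativity is a separate hypothesis
  since \<open>c\<close> may exceed 1.\<close>

lemma lazy_kernel_prob_vector:
  assumes "prob_vector (R i)" "\<And>j. 0 \<le> idm i j + c * (R i j - idm i j)"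
  shows "prob_vector (\<lambda>j. idm i j + c * (R i j - idm i j))"
proof -
  have "((\<lambda>j. (1 - c) * idm i j + c * R i j) has_sum (1 - c) * 1 + c * 1) UNIV"
    using assms(1) by (intro has_sum_add has_sum_cmult_right idm_has_sum) (simp add: prob_vector_def)
  then show ?thesis using assms(2) by (simp add: prob_vector_def algebra_simps)
qed

text \<open>As \<nu> is by definition the limit in law of the occupation measures, its
  identification is phrased as their convergence to the GEM sum; existence of the limit is part of
  the conclusion.\<close>

theorem mainTheorem5:
  fixes \<theta> :: real
    and Q :: "'x::countable \<Rightarrow> 'x \<Rightarrow> real"
    and \<mu> :: "'x \<Rightarrow> real"
    and N :: "'b measure"
    and X :: "nat \<Rightarrow> 'b \<Rightarrow> real"
    and T' :: "nat \<Rightarrow> 'b \<Rightarrow> 'x"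
    and G G' Q' :: "'x \<Rightarrow> 'x \<Rightarrow> real"
    and m :: nat
    and \<pi> :: "'x \<Rightarrow> real"
    and M :: "'a measure"
    and T :: "nat \<Rightarrow> 'a \<Rightarrow> 'x"
  assumes theta_pos: "\<theta> > 0"
    and Q_stoch: "stochastic Q"
    and no_absorbing: "\<forall>i. Q i i \<noteq> 1"
    and mu_stat: "stationary Q \<mu>"
    and N_prob: "prob_space N"
    and X_indep: "prob_space.indep_vars N (\<lambda>_. borel) X {1..}"
    and X_beta: "\<forall>j\<ge>1. distributed N lborel (X j) (beta_density 1 \<theta>)"
    and T'_chain: "markov_chain N T' \<mu> (\<lambda>_. Q)"
    and indep: "\<forall>A\<in>sets (Pi\<^sub>M {1..} (\<lambda>_. borel)). \<forall>B\<in>sets (Pi\<^sub>M {1..} (\<lambda>_. count_space UNIV)).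
                  measure N {\<omega>\<in>space N. restrict (\<lambda>j. X j \<omega>) {1..} \<in> A \<and> restrict (\<lambda>j. T' j \<omega>) {1..} \<in> B}
                  = measure N {\<omega>\<in>space N. restrict (\<lambda>j. X j \<omega>) {1..} \<in> A}
                    * measure N {\<omega>\<in>space N. restrict (\<lambda>j. T' j \<omega>) {1..} \<in> B}"
    and G_def: "G = (\<lambda>i j. \<theta> * (Q i j - idm i j))"
    and G'_def: "G' = (\<lambda>i j. \<mu> j / \<mu> i * G j i * (if \<mu> i \<noteq> 0 then 1 else 0))"
    and Q'_def: "Q' = (\<lambda>i j. idm i j + G' i j / \<theta>)"
    and m_bound: "real m > Inf {r::real. r > 0 \<and> (\<forall>i j. 0 \<le> idm i j + G' i j / r)}"
    and pi_prob: "prob_vector \<pi>"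
    and pi_conv: "\<forall>j. (\<lambda>n. \<Sum>\<^sub>\<infinity>i. \<pi> i * mpow Q' n i j) \<longlonglongrightarrow> \<mu> j"
    and M_prob: "prob_space M"
    and T_chain: "markov_chain M T \<pi>
                    (\<lambda>n i j. idm i j + G' i j / real n * (if n > m then 1 else 0))"
  shows "conv_in_distr M
           (\<lambda>n \<omega> l. (1 / real n) * (\<Sum>j\<in>{1..n}. if T j \<omega> = l then 1 else 0))
           N
           (\<lambda>\<omega> l. \<Sum>\<^sub>\<infinity>j\<in>{1..}. gem_weight (\<lambda>i. X i \<omega>) j * (if T' j \<omega> = l then 1 else 0))"
proof -
  let ?\<nu> = "\<lambda>n \<omega> l. (1 / real n) * (\<Sum>j\<in>{1..n}. if T j \<omega> = l then 1 else 0)"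
  let ?V = "\<lambda>\<omega> l. \<Sum>\<^sub>\<infinity>j\<in>{1..}. gem_weight (\<lambda>i. X i \<omega>) j * (if T' j \<omega> = l then 1 else 0)"
  let ?K = "\<lambda>n i j. idm i j + G' i j / real n * (if n > m then 1 else 0)"
  interpret M: prob_space M by (rule M_prob)
  interpret N: prob_space N by (rule N_prob)
  have Q'_eq: "Q' i j = (if \<mu> i = 0 then idm i j else \<mu> j * Q j i / \<mu> i)" for i j
    using theta_pos by (auto simp: Q'_def G'_def G_def idm_def field_simps)
  have Q': "prob_vector (Q' i)" "\<mu> i * Q' i j = \<mu> j * Q j i" for i j
    using reversed_kernel[OF mu_stat Q_stoch] unfolding Q'_eq[abs_def] by auto
  have "\<forall>i. \<exists>r. \<forall>j. pmf r j = Q' i j"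
    using pmf_of_prob_vector[OF Q'(1)] by metis
  then obtain q where q: "\<And>i j. pmf (q i) j = Q' i j" by metis
  define a where "a n = (if n > m then \<theta> / real n else 0)" for n
  have K_eq: "?K n i j = idm i j + a n * (Q' i j - idm i j)" for n i j
    using theta_pos by (simp add: a_def Q'_def)
  have K_nonneg: "0 \<le> idm i j + a n * (Q' i j - idm i j)" for n i j
  proof (cases "n > m")
    case True
    let ?S = "{r::real. r > 0 \<and> (\<forall>i j. 0 \<le> idm i j + G' i j / r)}"
    \<comment> \<open>\<open>I + G' / \<theta>\<close> is the stochastic matrix \<open>Q'\<close>,
      so the set is nonempty and the bound on its infimum yields a member \<open>r\<close> below
      \<open>m\<close>.\<close>
    have "\<theta> \<in> ?S" using theta_pos Q'(1) unfolding Q'_def prob_vector_def by auto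
    then obtain r where r: "r \<in> ?S" "r < real m"
      using cInf_lessD[of ?S "real m"] m_bound by blast
    \<comment> \<open>For \<open>n > m > r\<close> the kernel is a convex combination, with weight
      \<open>r / n\<close> on the nonnegative matrix \<open>I + G' / r\<close> and the rest on the
      identity.\<close>
    have "0 \<le> (1 - r / real n) * idm i j + r / real n * (idm i j + G' i j / r)"
    proof (rule add_nonneg_nonneg[OF mult_nonneg_nonneg mult_nonneg_nonneg])
      show "0 \<le> idm i j" by (simp add: idm_def)
    qed (use r True in auto)
    also have "\<dots> = ?K n i j" using r True by (simp add: field_simps)
    finally show ?thesis unfolding K_eq .
  qed (simp add: a_def idm_def)
  have "\<forall>n i. \<exists>r. \<forall>j. pmf r j = ?K n i j"
  proof (intro allI)
    fix n i
    have "prob_vector (\<lambda>j. ?K n i j)"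
      unfolding K_eq by (rule lazy_kernel_prob_vector[OF Q'(1) K_nonneg])
    then show "\<exists>r. \<forall>j. pmf r j = ?K n i j" by (rule pmf_of_prob_vector) blast
  qed
  then obtain \<kappa> where \<kappa>: "\<And>n i j. pmf (\<kappa> n i) j = ?K n i j" by metis
  interpret T: inhomogeneous_chain M T \<pi> q a \<kappa> \<theta> m
  proof
    show "markov_chain M T \<pi> (\<lambda>n i j. pmf (\<kappa> n i) j)" using T_chain by (simp add: \<kappa>)
    show "pmf (\<kappa> n i) j = idm i j + a n * (pmf (q i) j - idm i j)" for n i j
      unfolding \<kappa> K_eq q ..
  qed (use M_prob theta_pos in \<open>auto simp: a_def\<close>)
  interpret gem_chain N X \<theta> T' \<mu> Q q
    by unfold_locales (use N_prob theta_pos X_indep X_beta T'_chain indep Q'(2) in \<open>simp_all add: q\<close>)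
  obtain \<pi>p where \<pi>p: "\<And>i. pmf \<pi>p i = \<pi> i" 
    by (rule pmf_of_prob_vector[OF pi_prob]) blast
  obtain \<mu>p where \<mu>p: "\<And>i. pmf \<mu>p i = \<mu> i"
    by (rule pmf_of_prob_vector[of \<mu>]) (use mu_stat in \<open>auto simp: stationary_def\<close>)
  \<comment> \<open>The law \<pi> after \<open>k\<close> jumps along \<open>Q'\<close>; its entries
    are those in \<open>pi_conv\<close>.\<close>
  define p where "p k = bind_pmf \<pi>p (iterate_kernel q k)" for k
  have p_lim: "(\<lambda>k. pmf (p k) j) \<longlonglongrightarrow> pmf \<mu>p j" for j
  proof -
    have "pmf (p k) j = (\<Sum>\<^sub>\<infinity>i. \<pi> i * mpow Q' k i j)" for k
    proof -
      have "pmf (p k) j = (\<integral>i. pmf \<pi>p i * pmf (iterate_kernel q k i) j \<partial>count_space UNIV)"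
        by (simp add: p_def pmf_bind expectation_pmf_count_space)
      also have "\<dots> = (\<Sum>\<^sub>\<infinity>i. pmf \<pi>p i * pmf (iterate_kernel q k i) j)"
        by (rule infsumI[OF has_sum_of_integrable_count_space, symmetric])
          (rule integrable_pmf_count_space[where B = 1], simp add: pmf_le_1)
      finally show ?thesis by (simp add: \<pi>p mpow_eq_iterate_kernel[OF q])
    qed
    then show ?thesis using pi_conv by (simp add: \<mu>p)
  qed
  have T1: "(\<integral>\<omega>. F (T 1 \<omega>) \<partial>M) = measure_pmf.expectation \<pi>p F" for F :: "'x \<Rightarrow> real"
  proof -
    obtain r where r: "\<And>z. pmf r z = measure M {\<omega>\<in>space M. T 1 \<omega> = z}"
      "\<And>F :: 'x \<Rightarrow> real. (\<integral>\<omega>. F (T 1 \<omega>) \<partial>M) = measure_pmf.expectation r F"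
      by (rule law_pmf[OF M_prob T.measurable_T[of 1]]) (erule that)
    have "pmf r z = \<pi> z" for z
      using T_chain unfolding markov_chain_def r(1) by (auto dest!: spec[of _ "1::nat"] spec[of _ "\<lambda>_. z"])
    then have "r = \<pi>p" by (intro pmf_eqI) (simp add: \<pi>p)
    then show ?thesis using r(2) by simp
  qed
  have init: "eventually (\<lambda>k. T.mean_dist (\<lambda>_. 0) 0 (measure_pmf.expectation \<mu>p) 1 k e) sequentially"
    if "e > 0" for e
    using pmf_tendsto_total_variation[OF p_lim that]
  proof eventually_elim
    case (elim k)
    show ?case
      unfolding T.mean_dist_def
    proof (intro allI impI)
      fix g :: "'x \<Rightarrow> real" assume g: "unit_bounded g"
      \<comment> \<open>At time 1 the law is \<pi>, and averaging the \<open>k\<close>-th iterate of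
        \<open>g\<close> under \<pi> is the same as averaging \<open>g\<close> under
        \<open>p k\<close>.\<close>
      have eq: "measure_pmf.expectation (p k) g = (\<integral>\<omega>. (kernel_app q ^^ k) g (T 1 \<omega>) \<partial>M)"
        unfolding T1 p_def using expectation_bind_pmf[of g 1 \<pi>p "iterate_kernel q k"] unit_boundedD[OF g]
        by (simp add: expectation_iterate_kernel[OF g])
      then show "\<bar>(\<integral>\<omega>. T.avg (\<lambda>_. 0) 1 \<omega> ^ 0 * (kernel_app q ^^ k) g (T 1 \<omega>) \<partial>M)
          - measure_pmf.expectation \<mu>p g\<bar> \<le> e"
        using elim[rule_format, OF g] unfolding eq by simp
    qed
  qed
  have T_lim: "eventually (\<lambda>n. T.mean_dist (\<lambda>_. 0) 0 (measure_pmf.expectation \<mu>p) n 0 e) sequentially"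
    if "e > 0" for e
    by (rule T.T_tendsto[OF init _ that]) (auto intro: pmf_expectation_abs_le unit_boundedD)
  have moments: "(\<lambda>n. \<integral>\<omega>. T.avg h n \<omega> ^ r \<partial>M) \<longlonglongrightarrow> (\<integral>\<omega>. occupation h \<omega> ^ r \<partial>N)"
    if h: "unit_bounded h" for h r
  proof (rule LIMSEQ_I)
    fix e :: real assume "e > 0"
    then have e: "e / 2 > 0" by simp
    have one: "unit_bounded (\<lambda>_::'x. 1)" by (simp add: unit_bounded_def)
    have "eventually (\<lambda>n. T.mean_dist h r (occ_moment h r) n 0 (e / 2)) sequentially"
    proof (rule T.avg_moment_tendsto[OF h])
      show "eventually (\<lambda>n. T.mean_dist (\<lambda>_. 0) 0 (occ_moment h 0) n 0 e) sequentially" if "e > 0" for e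
        using T_lim[OF that] by (simp only: occ_moment_0[OF \<mu>p, abs_def])
      show "\<bar>occ_moment h r g\<bar> \<le> 1" if "unit_bounded g" for r g
        by (rule occ_moment_abs_le[OF h that])
    qed (fact e | erule (1) occ_moment_affine[OF h] | erule (1) occ_moment_rec[OF h, rotated])+
    then have "eventually (\<lambda>n. norm ((\<integral>\<omega>. T.avg h n \<omega> ^ r \<partial>M) - (\<integral>\<omega>. occupation h \<omega> ^ r \<partial>N)) < e) sequentially"
    proof eventually_elim
      case (elim n)
      from elim[unfolded T.mean_dist_def, rule_format, OF one] show ?case
        using \<open>e > 0\<close> by (simp add: occ_moment_def)
    qed
    then show "\<exists>n0. \<forall>n\<ge>n0. norm ((\<integral>\<omega>. T.avg h n \<omega> ^ r \<partial>M) - (\<integral>\<omega>. occupation h \<omega> ^ r \<partial>N)) < e"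
      by (simp add: eventually_sequentially)
  qed
  show ?thesis
  proof (rule conv_in_distr_exponentialsI[OF M_prob N_prob])
    show "(\<lambda>\<omega>. ?\<nu> n \<omega> l) \<in> borel_measurable M" for n l
      by measurable
    show "0 \<le> ?\<nu> n \<omega> l \<and> ?\<nu> n \<omega> l \<le> 1" for n \<omega> l
    proof -
      have "(\<Sum>j\<in>{1..n}. if T j \<omega> = l then 1 else 0) \<le> (\<Sum>j\<in>{1..n}. 1::real)"
        by (intro sum_mono) auto
      moreover have "0 \<le> (\<Sum>j\<in>{1..n}. if T j \<omega> = l then 1 else 0 :: real)"
        by (intro sum_nonneg) auto
      ultimately show ?thesis by (cases "n = 0") (auto simp: field_simps)
    qed
    show "(\<lambda>\<omega>. ?V \<omega> l) \<in> borel_measurable N" for l by (rule occupation_measure(1))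
    show "AE \<omega> in N. \<forall>l. 0 \<le> ?V \<omega> l \<and> ?V \<omega> l \<le> 1" by (rule occupation_measure(2))
    fix F :: "'x set" and h :: "'x \<Rightarrow> real" assume F: "finite F"
    \<comment> \<open>Scales the linear form into \<open>[-1, 1]\<close>; the summand 1 keeps
      \<open>B\<close> positive when every \<open>h l\<close> on \<open>F\<close> is 0.\<close>
    define B where "B = (\<Sum>l\<in>F. \<bar>h l\<bar>) + 1"
    have B: "B > 0" unfolding B_def by (simp add: sum_nonneg add_nonneg_pos)
    define k where "k x = (if x \<in> F then h x / B else 0)" for x
    have k: "unit_bounded k"
      unfolding unit_bounded_def
    proof
      fix x
      have "\<bar>h x\<bar> \<le> B" if "x \<in> F"
        unfolding B_def using member_le_sum[OF that, of "\<lambda>l. \<bar>h l\<bar>"] F by auto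
      then show "\<bar>k x\<bar> \<le> 1" using B by (simp add: k_def)
    qed
    have left: "(\<Sum>l\<in>F. h l * ?\<nu> n \<omega> l) = B * T.avg k n \<omega>" for n \<omega>
    proof -
      have "(\<Sum>l\<in>F. h l * ?\<nu> n \<omega> l) = (\<Sum>l\<in>F. \<Sum>j\<in>{1..n}. (1 / real n) * (if T j \<omega> = l then h l else 0))"
        by (simp add: sum_distrib_left mult_ac if_distrib cong: if_cong)
      also have "\<dots> = (\<Sum>j\<in>{1..n}. \<Sum>l\<in>F. (1 / real n) * (if T j \<omega> = l then h l else 0))"
        by (rule sum.swap)
      also have "\<dots> = (\<Sum>j\<in>{1..n}. (1 / real n) * (B * k (T j \<omega>)))"
      proof (intro sum.cong refl)
        fix j
        show "(\<Sum>l\<in>F. (1 / real n) * (if T j \<omega> = l then h l else 0)) = (1 / real n) * (B * k (T j \<omega>))"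
          unfolding sum_distrib_left[symmetric] using F B by (simp add: k_def)
      qed
      finally show ?thesis
        unfolding T.avg_def by (simp add: sum_distrib_left[symmetric] sum_divide_distrib[symmetric])
    qed
    have "AE \<omega> in N. (\<Sum>l\<in>F. h l / B * ?V \<omega> l) = occupation k \<omega>"
      using occupation_measure(3)[OF F, of "\<lambda>l. h l / B"] unfolding k_def[abs_def] .
    then have right: "AE \<omega> in N. (\<Sum>l\<in>F. h l * ?V \<omega> l) = B * occupation k \<omega>"
    proof eventually_elim
      case (elim \<omega>)
      show ?case unfolding elim[symmetric] sum_distrib_left using B by (intro sum.cong) auto
    qed
    have "(\<integral>\<omega>. exp (\<Sum>l\<in>F. h l * ?V \<omega> l) \<partial>N) = (\<integral>\<omega>. exp (B * occupation k \<omega>) \<partial>N)"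
    proof (rule integral_cong_AE)
      have [measurable]: "(\<lambda>\<omega>. ?V \<omega> l) \<in> borel_measurable N" for l by (rule occupation_measure(1))
      show "(\<lambda>\<omega>. exp (\<Sum>l\<in>F. h l * ?V \<omega> l)) \<in> borel_measurable N" by measurable
      show "AE \<omega> in N. exp (\<Sum>l\<in>F. h l * ?V \<omega> l) = exp (B * occupation k \<omega>)"
        using right by eventually_elim simp
    qed measurable
    moreover have "(\<lambda>n. \<integral>\<omega>. exp (B * T.avg k n \<omega>) \<partial>M) \<longlonglongrightarrow> (\<integral>\<omega>. exp (B * occupation k \<omega>) \<partial>N)"
      by (rule exp_expectation_tendsto[OF M_prob N_prob T.measurable_avg measurable_occupation _ AE_occupation_le[OF k] moments[OF k]])
        (use T.avg_abs_le[OF k] in simp)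
    ultimately show "(\<lambda>n. \<integral>\<omega>. exp (\<Sum>l\<in>F. h l * ?\<nu> n \<omega> l) \<partial>M) \<longlonglongrightarrow> (\<integral>\<omega>. exp (\<Sum>l\<in>F. h l * ?V \<omega> l) \<partial>N)"
      by (simp only: left)
  qed
qed

end
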